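(* Let $\mu\in\mathbb{R}$. There exist a real $2\times2$ matrix-valued function $A=A_\mu(x,y,t)$ on $\mathbb{T}^2\times\mathbb{R}^+$ in the regularity class $R(100,61)$ and a non-zero, uniformly $C^2$, real function $u=u_\mu$ on $\mathbb{T}^2\times\mathbb{R}^+$ such that $$\ddot u+\operatorname{div}(A\nabla u)=-\mu u\quad\text{in }\mathbb{T}^2\times\mathbb{R}^+,$$ and, for some constants $c(\mu),C(\mu)>0$ and all sufficiently large $T$, $\sup_{\mathbb{T}^2\times\{t\ge T\}}|u|\le Ce^{-ce^{cT}}$. Moreover, there is a positive integer $k$ with $|\mu|/k^2\le 1/1000$ such that on $\mathbb{T}^2\times[0,\tfrac1{100}]$, $$u(x,y,t)=\cos(kx)e^{-kt},\qquad A=\mathrm{Id}+\begin{pmatrix}\mu/k^2&0\\0&\mu/(4k^2)\end{pmatrix}.$$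
   Context: $\mathbb{T}^2=(\mathbb{R}/2\pi\mathbb{Z})^2$ with coordinates $(x,y)$; $t\ge0$ the third coordinate. For a real $2\times2$ matrix function $A(x,y,t)$, $\ddot u+\operatorname{div}(A\nabla u)$ means $\partial_t^2u+\sum_{i,j\in\{x,y\}}\partial_i(A_{ij}\partial_ju)$. Regularity class $R(\Lambda,C)$: $A$ satisfies $\Lambda^{-1}|\xi|^2\le\xi^TA\xi\le\Lambda|\xi|^2$ for all $\xi\in\mathbb{R}^2$ at every point, and the entries of $A$ are $C^1$ with all first partial derivatives (in $x,y,t$) bounded by $C$ in absolute value. Uniformly $C^2$: all partial derivatives of order $\le2$ are continuous and bounded. *)

theory Defs
  imports "HOL-Analysis.Analysis"
begin

type_synonym pt = "real \<times> real \<times> real"  (* (x, y, t) *)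

definition tc :: "pt \<Rightarrow> real" where "tc p = snd (snd p)"

definition ev :: "nat \<Rightarrow> pt" where
  "ev i = (if i = 0 then (1,0,0) else if i = 1 then (0,1,0) else (0,0,1))"

definition pd :: "nat \<Rightarrow> (pt \<Rightarrow> real) \<Rightarrow> pt \<Rightarrow> real" where
  "pd i f p = deriv (\<lambda>s. f (p + s *\<^sub>R ev i)) 0"

text \<open>Open half space T^2 x R^+ (lifted to the universal cover).\<close>
definition Hplus :: "pt set" where "Hplus = {p. tc p > 0}"

definition periodic2 :: "(pt \<Rightarrow> real) \<Rightarrow> bool" where
  "periodic2 f \<longleftrightarrow> (\<forall>x y t. f (x + 2*pi, y, t) = f (x, y, t) \<and> f (x, y + 2*pi, t) = f (x, y, t))"

definition C1_on :: "pt set \<Rightarrow> (pt \<Rightarrow> real) \<Rightarrow> bool" where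
  "C1_on S f \<longleftrightarrow> continuous_on S f \<and>
     (\<forall>i<3. \<forall>p\<in>S. (\<lambda>s. f (p + s *\<^sub>R ev i)) differentiable (at 0)) \<and>
     (\<forall>i<3. continuous_on S (pd i f))"

definition uniformly_C2_on :: "pt set \<Rightarrow> (pt \<Rightarrow> real) \<Rightarrow> bool" where
  "uniformly_C2_on S f \<longleftrightarrow> C1_on S f \<and> (\<forall>i<3. C1_on S (pd i f)) \<and>
     bounded (f ` S) \<and> (\<forall>i<3. bounded (pd i f ` S)) \<and>
     (\<forall>i<3. \<forall>j<3. bounded (pd j (pd i f) ` S))"

definition reg_class :: "pt set \<Rightarrow> real \<Rightarrow> real \<Rightarrow> (nat \<Rightarrow> nat \<Rightarrow> pt \<Rightarrow> real) \<Rightarrow> bool" where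
  "reg_class S \<Lambda> C A \<longleftrightarrow>
     (\<forall>p\<in>S. \<forall>\<xi>0 \<xi>1::real.
        (1/\<Lambda>) * (\<xi>0^2 + \<xi>1^2) \<le> (\<Sum>i<2. \<Sum>j<2. (if i = 0 then \<xi>0 else \<xi>1) * A i j p * (if j = 0 then \<xi>0 else \<xi>1)) \<and>
        (\<Sum>i<2. \<Sum>j<2. (if i = 0 then \<xi>0 else \<xi>1) * A i j p * (if j = 0 then \<xi>0 else \<xi>1)) \<le> \<Lambda> * (\<xi>0^2 + \<xi>1^2)) \<and>
     (\<forall>i<2. \<forall>j<2. C1_on S (A i j) \<and> (\<forall>l<3. \<forall>p\<in>S. \<bar>pd l (A i j) p\<bar> \<le> C))"

end

theory Submission
  imports Defs
begin

text \<open>The solution doubles its frequency during every time step of a fixed length, so that its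
  decay rate grows exponentially in time. A step starts from \<open>exp (- K s) cos Kx\<close> and ends with a
  multiple of \<open>exp (- 2 K s) cos 2Ky\<close>; the next step is the same with \<open>x\<close> and \<open>y\<close> exchanged.
  A mode \<open>f(s) cos Kx\<close> only feels the diagonal entry \<open>(f''/f + \<mu>) / K^2\<close>, and the entry belonging
  to an absent mode is free. Hence one first lowers the yy-entry to 1/4, for which
  \<open>exp (- K s) cos 2Ky\<close> is a solution with the same decay rate as the old mode; one cuts this mode in,
  cuts the old one out, and finally accelerates the decay of the remaining mode from rate \<open>K\<close> to
  \<open>2K\<close>. The errors made by cutting in and out are absorbed by small perturbations of the matrix;
  all of this is slow, so that the Lipschitz bound holds uniformly in \<open>K\<close>.\<close>

subsection \<open>A slow cutoff\<close>

text \<open>Clamping is 1-Lipschitz, so wherever \<open>Q'\<close> vanishes at the clamped value the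
  little-o estimate for \<open>Q\<close> carries over to the composition. This treats the corners 0
  and 1 and the outside at once, without one-sided derivatives.\<close>

lemma clamp_has_real_derivative:
  fixes Q Q' :: "real \<Rightarrow> real"
  assumes Q: "\<And>c. (Q has_real_derivative Q' c) (at c)" and "Q' 0 = 0" "Q' 1 = 0"
  shows "((\<lambda>x. Q (max 0 (min 1 x))) has_real_derivative Q' (max 0 (min 1 x))) (at x)"
proof (cases "0 < x \<and> x < 1")
  case True
  have "\<forall>\<^sub>F y in nhds x. y \<in> {0<..<1}"
    using True by (intro eventually_nhds_in_open) auto
  then have "\<forall>\<^sub>F y in nhds x. Q (max 0 (min 1 y)) = Q y"
    by eventually_elim auto
  then show ?thesis
    using Q[of x] True DERIV_cong_ev[OF refl _ refl, of "\<lambda>y. Q (max 0 (min 1 y))" Q x "Q' x"] by simp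
next
  case False
  define c where "c = max 0 (min 1 x)"
  have c: "Q' c = 0"
    using False assms(2,3) unfolding c_def by (auto simp: max_def min_def)
  have "(Q has_derivative (\<lambda>_. 0)) (at c)"
    using Q[of c] c by (simp add: has_field_derivative_def lambda_zero)
  then have e: "\<exists>d>0. \<forall>y. norm (y - c) < d \<longrightarrow> norm (Q y - Q c) \<le> e * norm (y - c)" if "e > 0" for e
    using that unfolding has_derivative_at_alt by simp
  have lip: "\<bar>max 0 (min 1 y) - c\<bar> \<le> \<bar>y - x\<bar>" for y
    unfolding c_def by (auto simp: max_def min_def)
  have "((\<lambda>x. Q (max 0 (min 1 x))) has_derivative (\<lambda>_. 0)) (at x)"
    unfolding has_derivative_at_alt
  proof (intro conjI allI impI)
    fix e :: real assume "e > 0"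
    then obtain d where d: "d > 0" "\<And>y. norm (y - c) < d \<Longrightarrow> norm (Q y - Q c) \<le> e * norm (y - c)"
      using e by blast
    have "norm (Q (max 0 (min 1 y)) - Q c) \<le> e * norm (y - x)" if "norm (y - x) < d" for y
    proof -
      have "norm (Q (max 0 (min 1 y)) - Q c) \<le> e * norm (max 0 (min 1 y) - c)"
        using that lip[of y] by (intro d(2)) auto
      also have "\<dots> \<le> e * norm (y - x)"
        using \<open>e > 0\<close> lip[of y] by (intro mult_left_mono) auto
      finally show ?thesis .
    qed
    then show "\<exists>d>0. \<forall>y. norm (y - x) < d \<longrightarrow>
        norm (Q (max 0 (min 1 y)) - Q (max 0 (min 1 x)) - 0) \<le> e * norm (y - x)"
      using d(1) unfolding c_def by auto
  qed auto
  then show ?thesis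
    using c unfolding c_def by (simp add: has_field_derivative_def lambda_zero)
qed

text \<open>Three derivatives are recorded because the matrix will contain \<theta>'' and must be
  C^1. \<open>X\<close> is the antiderivative of \<theta> starting from zero; \<kappa> is the
  integral of 1 - \<theta> over the transition interval, the delay of \<open>X\<close> behind the
  identity.\<close>

locale cutoff =
  fixes \<theta> \<theta>1 \<theta>2 \<theta>3 X :: "real \<Rightarrow> real" and L \<kappa> :: real
  assumes ell: "L \<ge> 1"
    and deriv_theta: "\<And>s. (\<theta> has_real_derivative \<theta>1 s) (at s)"
      "\<And>s. (\<theta>1 has_real_derivative \<theta>2 s) (at s)"
      "\<And>s. (\<theta>2 has_real_derivative \<theta>3 s) (at s)"
      "\<And>s. (X has_real_derivative \<theta> s) (at s)"
    and cont_theta3: "continuous_on UNIV \<theta>3"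
    and before: "\<And>s. s \<le> 0 \<Longrightarrow> \<theta> s = 0 \<and> \<theta>1 s = 0 \<and> \<theta>2 s = 0 \<and> \<theta>3 s = 0 \<and> X s = 0"
    and after: "\<And>s. s \<ge> L \<Longrightarrow> \<theta> s = 1 \<and> \<theta>1 s = 0 \<and> \<theta>2 s = 0 \<and> \<theta>3 s = 0 \<and> X s = s - \<kappa>"
    and theta_range: "\<And>s. 0 \<le> \<theta> s" "\<And>s. \<theta> s \<le> 1"
    and theta_small: "\<And>s. \<bar>\<theta>1 s\<bar> \<le> 1/100" "\<And>s. \<bar>\<theta>2 s\<bar> \<le> 1/100" "\<And>s. \<bar>\<theta>3 s\<bar> \<le> 1/100"
    and X_nonneg: "\<And>s. 0 \<le> X s"

lemma cutoff_exists: "\<exists>\<theta> \<theta>1 \<theta>2 \<theta>3 X L \<kappa>. cutoff \<theta> \<theta>1 \<theta>2 \<theta>3 X L \<kappa>"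
proof -
  \<comment> \<open>\<open>P\<close> is the degree 7 smoothstep: its derivative is a multiple of
    (c(1-c))^3, with 140 making \<open>P 1 = 1\<close>. Its first three derivatives vanish at both
    ends, so the clamped function is C^3.\<close>
  define P P1 P2 P3 :: "real \<Rightarrow> real" where
    "P c = 35*c^4 - 84*c^5 + 70*c^6 - 20*c^7" and
    "P1 c = 140 * (c*(1-c))^3" and
    "P2 c = 420 * (c*(1-c))^2 * (1-2*c)" and
    "P3 c = 840 * (c*(1-c)) * (1-5*(c*(1-c)))" for c
  have D: "(P has_real_derivative P1 c) (at c)" "(P1 has_real_derivative P2 c) (at c)"
    "(P2 has_real_derivative P3 c) (at c)" for c
    unfolding P_def P1_def P2_def P3_def
    by (rule derivative_eq_intros refl | simp | simp add: algebra_simps eval_nat_numeral)+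
  have P1_nonneg: "0 \<le> P1 c" if "0 \<le> c" "c \<le> 1" for c
    using that by (simp add: P1_def)
  have mono: "P a \<le> P b" if "0 \<le> a" "a \<le> b" "b \<le> 1" for a b
    by (rule DERIV_nonneg_imp_nondecreasing[OF that(2)]) (use D(1) P1_nonneg that in force)
  \<comment> \<open>Stretching by 300 turns the bound 3 on \<open>P1\<close> into 1/100; the higher
    derivatives gain further powers of 300.\<close>
  define L :: real where "L = 300"
  define cl where "cl s = max 0 (min 1 (s / L))" for s
  have cl: "0 \<le> cl s" "cl s \<le> 1" for s by (auto simp: cl_def)
  have cl0: "cl s = 0" if "s \<le> 0" for s
    using that by (simp add: cl_def L_def)
  have cl1: "cl s = 1" if "s \<ge> L" for s
    using that by (simp add: cl_def L_def)
  define \<theta> \<theta>1 \<theta>2 \<theta>3 where "\<theta> s = P (cl s)" and "\<theta>1 s = P1 (cl s) / L"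
    and "\<theta>2 s = P2 (cl s) / L^2" and "\<theta>3 s = P3 (cl s) / L^3" for s
  have chain: "((\<lambda>s. Q (cl s) / L^m) has_real_derivative Q' (cl s) / L^(Suc m)) (at s)"
    if "\<And>c. (Q has_real_derivative Q' c) (at c)" "Q' 0 = 0" "Q' 1 = 0" for Q Q' s m
  proof -
    have "((\<lambda>s. Q (max 0 (min 1 (s / L)))) has_real_derivative Q' (cl s) * (1 / L)) (at s)"
      unfolding cl_def
      by (rule DERIV_chain2[where f = "\<lambda>x. Q (max 0 (min 1 x))" and g = "\<lambda>s. s / L", OF clamp_has_real_derivative])
         (use that in \<open>auto intro!: derivative_eq_intros simp: L_def\<close>)
    from DERIV_cdivide[OF this, of "L^m"] show ?thesis by (simp add: cl_def)
  qed
  have d: "(\<theta> has_real_derivative \<theta>1 s) (at s)" "(\<theta>1 has_real_derivative \<theta>2 s) (at s)"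
     "(\<theta>2 has_real_derivative \<theta>3 s) (at s)" for s
    using chain[of P P1 0, OF D(1)] chain[of P1 P2 1, OF D(2)] chain[of P2 P3 2, OF D(3)]
    by (auto simp: \<theta>_def[abs_def] \<theta>1_def[abs_def] \<theta>2_def[abs_def] \<theta>3_def P1_def P2_def P3_def eval_nat_numeral)
  have "\<exists>F. \<forall>x::real. - \<infinity> < ereal x \<longrightarrow> ereal x < \<infinity> \<longrightarrow> (F has_vector_derivative \<theta> x) (at x)"
    by (rule einterval_antiderivative) (use d(1) in \<open>auto intro: DERIV_isCont\<close>)
  then obtain F where F: "\<And>s. (F has_real_derivative \<theta> s) (at s)"
    by (auto simp: has_real_derivative_iff_has_vector_derivative)
  define X where "X s = F s - F 0" for s
  have dX: "(X has_real_derivative \<theta> s) (at s)" for s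
    unfolding X_def by (auto intro!: derivative_eq_intros F)
  have lo: "\<theta> s = 0" if "s \<le> 0" for s
    using cl0[OF that] by (simp add: \<theta>_def P_def)
  have hi: "\<theta> s = 1" if "s \<ge> L" for s
    using cl1[OF that] by (simp add: \<theta>_def P_def)
  have range: "0 \<le> \<theta> s" "\<theta> s \<le> 1" for s
    using mono[of 0 "cl s"] mono[of "cl s" 1] cl[of s]
    by (auto simp: \<theta>_def P_def)
  have X0: "X s = 0" if "s \<le> 0" for s
  proof (cases "s = 0")
    case False
    then have "s < 0" using that by simp
    then have "\<exists>z>s. z < 0 \<and> X 0 - X s = (0 - s) * \<theta> z"
      by (rule MVT2) (use dX in auto)
    then show ?thesis using lo by (auto simp: X_def)
  qed (simp add: X_def)
  have XL: "X s = s - (L - X L)" if "s \<ge> L" for s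
  proof (cases "s = L")
    case False
    then have "L < s" using that by simp
    then have "\<exists>z>L. z < s \<and> X s - X L = (s - L) * \<theta> z"
      by (rule MVT2) (use dX in auto)
    then show ?thesis using hi by auto
  qed simp
  have Xn: "0 \<le> X s" for s
  proof (cases "s \<le> 0")
    case False
    then have "\<exists>z>0. z < s \<and> X s - X 0 = (s - 0) * \<theta> z"
      by (intro MVT2) (use dX in auto)
    then show ?thesis using range False X0[of 0] by auto
  qed (use X0 in auto)
  have q: "0 \<le> c * (1 - c)" "c * (1 - c) \<le> 1/4" if "0 \<le> c" "c \<le> 1" for c :: real
    using mult_nonneg_nonneg[of c "1 - c"] that zero_le_power2[of "c - 1/2"] by (auto simp: power2_eq_square algebra_simps)
  have b: "\<bar>P1 c\<bar> \<le> 3" "\<bar>P2 c\<bar> \<le> 27" "\<bar>P3 c\<bar> \<le> 210" if c: "0 \<le> c" "c \<le> 1" for c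
  proof -
    define x where "x = c * (1 - c)"
    have x: "0 \<le> x" "x \<le> 1/4" using q[OF c] by (simp_all add: x_def)
    have "\<bar>x^3\<bar> \<le> (1/4)^3"
      unfolding power_abs using x by (intro power_mono) auto
    then show "\<bar>P1 c\<bar> \<le> 3" by (simp add: P1_def x_def[symmetric] abs_mult eval_nat_numeral)
    have "\<bar>x^2\<bar> * \<bar>1 - 2*c\<bar> \<le> (1/4)^2 * 1"
      unfolding power_abs using x c by (intro mult_mono power_mono) auto
    then show "\<bar>P2 c\<bar> \<le> 27" by (simp add: P2_def x_def[symmetric] abs_mult eval_nat_numeral)
    have "\<bar>x\<bar> * \<bar>1 - 5*x\<bar> \<le> (1/4) * 1"
      using x by (intro mult_mono) (auto simp: abs_le_iff)
    then show "\<bar>P3 c\<bar> \<le> 210" by (simp add: P3_def x_def[symmetric] abs_mult)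
  qed
  have "cutoff \<theta> \<theta>1 \<theta>2 \<theta>3 X L (L - X L)"
  proof
    show "continuous_on UNIV \<theta>3"
      unfolding \<theta>3_def P3_def cl_def by (intro continuous_intros) (auto simp: L_def)
    show "\<theta> s = 0 \<and> \<theta>1 s = 0 \<and> \<theta>2 s = 0 \<and> \<theta>3 s = 0 \<and> X s = 0" if "s \<le> 0" for s
      using lo[OF that] X0[OF that] cl0[OF that] by (simp add: \<theta>1_def \<theta>2_def \<theta>3_def P1_def P2_def P3_def)
    show "\<theta> s = 1 \<and> \<theta>1 s = 0 \<and> \<theta>2 s = 0 \<and> \<theta>3 s = 0 \<and> X s = s - (L - X L)" if "s \<ge> L" for s
      using hi[OF that] XL[OF that] cl1[OF that] by (simp add: \<theta>1_def \<theta>2_def \<theta>3_def P1_def P2_def P3_def)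
    show "\<bar>\<theta>1 s\<bar> \<le> 1/100" "\<bar>\<theta>2 s\<bar> \<le> 1/100" "\<bar>\<theta>3 s\<bar> \<le> 1/100" for s
      using b[OF cl[of s]] by (simp_all add: \<theta>1_def \<theta>2_def \<theta>3_def L_def)
  qed (use d dX range Xn in \<open>simp_all add: L_def\<close>)
  then show ?thesis by blast
qed

subsection \<open>Directional derivatives and gluing\<close>

text \<open>The relational form of \<open>pd\<close> also carries differentiability. It is demanded
  on all of space, since the construction extends to negative times.\<close>

definition hasD :: "nat \<Rightarrow> (pt \<Rightarrow> real) \<Rightarrow> (pt \<Rightarrow> real) \<Rightarrow> bool" where
  "hasD i f f' \<longleftrightarrow> (\<forall>p. ((\<lambda>s. f (p + s *\<^sub>R ev i)) has_real_derivative f' p) (at 0))"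

lemma hasD_pd: "hasD i f f' \<Longrightarrow> pd i f = f'"
  by (auto simp: hasD_def pd_def fun_eq_iff intro: DERIV_imp_deriv)

lemma hasD_mult:
  "hasD i f f' \<Longrightarrow> hasD i g g' \<Longrightarrow> hasD i (\<lambda>p. f p * g p) (\<lambda>p. f' p * g p + f p * g' p)"
  unfolding hasD_def by (auto intro!: derivative_eq_intros)

lemma hasD_cmult: "hasD i f f' \<Longrightarrow> hasD i (\<lambda>p. c * f p) (\<lambda>p. c * f' p)"
  unfolding hasD_def by (auto intro!: derivative_eq_intros)

lemma C1_onI:
  assumes "continuous_on UNIV f"
    and "\<And>i. i < 3 \<Longrightarrow> hasD i f (f' i)" "\<And>i. i < 3 \<Longrightarrow> continuous_on UNIV (f' i)"
  shows "C1_on S f"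
  unfolding C1_on_def
proof (intro conjI allI impI ballI)
  fix i :: nat assume i: "i < 3"
  show "continuous_on S (pd i f)"
    using assms(3)[OF i] hasD_pd[OF assms(2)[OF i]] by (auto intro: continuous_on_subset)
  show "(\<lambda>s. f (p + s *\<^sub>R ev i)) differentiable (at 0)" for p
    using assms(2)[OF i] real_differentiable_def unfolding hasD_def by blast
qed (use assms(1) in \<open>auto intro: continuous_on_subset\<close>)

section \<open>Trigonometric ansatz for the solution and for the matrix entries\<close>

definition modes ::
  "real \<Rightarrow> (real \<Rightarrow> real) \<Rightarrow> (real \<Rightarrow> real) \<Rightarrow> (real \<Rightarrow> real) \<Rightarrow> (real \<Rightarrow> real) \<Rightarrow> pt \<Rightarrow> real" where
  "modes K a \<phi> b \<psi> p = a (tc p) * \<phi> (K * fst p) + b (tc p) * \<psi> (2 * K * fst (snd p))"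

definition prodmode ::
  "real \<Rightarrow> (real \<Rightarrow> real) \<Rightarrow> (real \<Rightarrow> real) \<Rightarrow> (real \<Rightarrow> real) \<Rightarrow> (real \<Rightarrow> real) \<Rightarrow> pt \<Rightarrow> real" where
  "prodmode K m h \<phi> \<psi> p = m (tc p) + h (tc p) * \<phi> (K * fst p) * \<psi> (2 * K * fst (snd p))"

lemma ev_simps:
  "fst (p + s *\<^sub>R ev i) = (if i = 0 then fst p + s else fst p)"
  "fst (snd (p + s *\<^sub>R ev i)) = (if i = 1 then fst (snd p) + s else fst (snd p))"
  "tc (p + s *\<^sub>R ev i) = (if i = 0 \<or> i = 1 then tc p else tc p + s)"
  by (auto simp: ev_def tc_def)

lemma affine_has_real_derivative:
  assumes "\<And>z. (\<phi> has_real_derivative \<phi>' z) (at z)"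
  shows "((\<lambda>s. \<phi> (K * (x + s))) has_real_derivative K * \<phi>' (K * x)) (at 0)"
proof -
  have *: "((\<lambda>s. K * (x + s)) has_real_derivative K) (at 0)"
    by (auto intro!: derivative_eq_intros)
  show ?thesis
    by (rule DERIV_cong[OF DERIV_chain2[of \<phi> _ "\<lambda>s. K * (x + s)", OF assms *]]) simp
qed

text \<open>The chain-rule factors \<open>K\<close> and \<open>2 * K\<close> are absorbed into the
  new amplitudes, so that a derivative of a two-mode sum has the same shape. The profile that meets
  a zero amplitude (\<open>\<psi>0\<close> or \<open>\<phi>0\<close>) is arbitrary.\<close>

lemma hasD_modes:
  assumes "\<And>z. (\<phi> has_real_derivative \<phi>' z) (at z)" "\<And>z. (\<psi> has_real_derivative \<psi>' z) (at z)"
  shows "(\<And>s. a' s = K * a s) \<Longrightarrow> (\<And>s. b' s = 0) \<Longrightarrow>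
       hasD 0 (modes K a \<phi> b \<psi>) (modes K a' \<phi>' b' \<psi>0)"
    and "(\<And>s. a' s = 0) \<Longrightarrow> (\<And>s. b' s = 2 * K * b s) \<Longrightarrow>
       hasD (Suc 0) (modes K a \<phi> b \<psi>) (modes K a' \<phi>0 b' \<psi>')"
    and "(\<And>z. (a has_real_derivative a' z) (at z)) \<Longrightarrow> (\<And>z. (b has_real_derivative b' z) (at z)) \<Longrightarrow>
       hasD 2 (modes K a \<phi> b \<psi>) (modes K a' \<phi> b' \<psi>)"
  unfolding hasD_def modes_def ev_simps
  using affine_has_real_derivative[of \<phi> \<phi>' K, OF assms(1)] affine_has_real_derivative[of \<psi> \<psi>' "2*K", OF assms(2)]
    affine_has_real_derivative[of a a' 1] affine_has_real_derivative[of b b' 1]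
  by (auto intro!: derivative_eq_intros)

lemma hasD_prodmode:
  assumes "\<And>z. (\<phi> has_real_derivative \<phi>' z) (at z)" "\<And>z. (\<psi> has_real_derivative \<psi>' z) (at z)"
  shows "(\<And>s. h' s = K * h s) \<Longrightarrow>
       hasD 0 (prodmode K m h \<phi> \<psi>) (prodmode K (\<lambda>_. 0) h' \<phi>' \<psi>)"
    and "(\<And>s. h' s = 2 * K * h s) \<Longrightarrow>
       hasD (Suc 0) (prodmode K m h \<phi> \<psi>) (prodmode K (\<lambda>_. 0) h' \<phi> \<psi>')"
    and "(\<And>z. (m has_real_derivative m' z) (at z)) \<Longrightarrow> (\<And>z. (h has_real_derivative h' z) (at z)) \<Longrightarrow>
       hasD 2 (prodmode K m h \<phi> \<psi>) (prodmode K m' h' \<phi> \<psi>)"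
  unfolding hasD_def prodmode_def ev_simps
  using affine_has_real_derivative[of \<phi> \<phi>' K, OF assms(1)] affine_has_real_derivative[of \<psi> \<psi>' "2*K", OF assms(2)]
    affine_has_real_derivative[of m m' 1] affine_has_real_derivative[of h h' 1]
  by (auto intro!: derivative_eq_intros)

lemma continuous_modes:
  assumes "continuous_on UNIV a" "continuous_on UNIV b" "continuous_on UNIV \<phi>" "continuous_on UNIV \<psi>"
  shows "continuous_on S (modes K a \<phi> b \<psi>)"
  unfolding modes_def[abs_def] tc_def
  by (intro continuous_intros continuous_on_compose2[OF assms(1)] continuous_on_compose2[OF assms(2)]
      continuous_on_compose2[OF assms(3)] continuous_on_compose2[OF assms(4)]) auto

lemma continuous_prodmode:
  assumes "continuous_on UNIV m" "continuous_on UNIV h" "continuous_on UNIV \<phi>" "continuous_on UNIV \<psi>"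
  shows "continuous_on S (prodmode K m h \<phi> \<psi>)"
  unfolding prodmode_def[abs_def] tc_def
  by (intro continuous_intros continuous_on_compose2[OF assms(1)] continuous_on_compose2[OF assms(2)]
      continuous_on_compose2[OF assms(3)] continuous_on_compose2[OF assms(4)]) auto

lemma modes_bound:
  assumes "\<bar>a (tc p)\<bar> \<le> M" "\<bar>b (tc p)\<bar> \<le> M" "\<And>z. \<bar>\<phi> z\<bar> \<le> 1" "\<And>z. \<bar>\<psi> z\<bar> \<le> 1"
  shows "\<bar>modes K a \<phi> b \<psi> p\<bar> \<le> 2 * M"
proof -
  have "\<bar>a (tc p) * \<phi> (K * fst p)\<bar> \<le> M * 1" "\<bar>b (tc p) * \<psi> (2 * K * fst (snd p))\<bar> \<le> M * 1"
    unfolding abs_mult using assms by (intro mult_mono; auto intro: order.trans[OF abs_ge_zero])+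
  then show ?thesis unfolding modes_def by linarith
qed

lemma prodmode_bound:
  assumes "\<bar>h (tc p)\<bar> \<le> M" "\<And>z. \<bar>\<phi> z\<bar> \<le> 1" "\<And>z. \<bar>\<psi> z\<bar> \<le> 1"
  shows "\<bar>prodmode K m h \<phi> \<psi> p - m (tc p)\<bar> \<le> M"
proof -
  have "\<bar>h (tc p) * \<phi> (K * fst p) * \<psi> (2 * K * fst (snd p))\<bar> \<le> M * 1 * 1"
    unfolding abs_mult using assms by (intro mult_mono) (auto intro: order.trans[OF abs_ge_zero])
  then show ?thesis unfolding prodmode_def by simp
qed

section \<open>Gluing pieces along the time axis\<close>

locale gluing =
  fixes T \<delta> :: real
  assumes T: "0 < \<delta>" "\<delta> \<le> T"
begin

text \<open>Negative times get index 0 because \<open>nat\<close> truncates, so the first piece also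
  serves to the left of 0.\<close>

definition idx :: "real \<Rightarrow> nat" where "idx t = nat \<lfloor>t / T\<rfloor>"

definition glue :: "(nat \<Rightarrow> pt \<Rightarrow> real) \<Rightarrow> pt \<Rightarrow> real" where
  "glue F p = F (idx (tc p)) p"

definition compat :: "(nat \<Rightarrow> pt \<Rightarrow> real) \<Rightarrow> bool" where
  "compat F \<longleftrightarrow> (\<forall>n p. \<bar>tc p - real (Suc n) * T\<bar> < \<delta> \<longrightarrow> F n p = F (Suc n) p)"

lemma T_pos: "0 < T"
  using T by simp

lemma idx_eq: "real n * T \<le> t \<Longrightarrow> t < real (Suc n) * T \<Longrightarrow> idx t = n"
  unfolding idx_def using T_pos by (subst floor_unique[of "int n"]) (auto simp: field_simps)

lemma idx_0: "t < T \<Longrightarrow> idx t = 0"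
  unfolding idx_def using T_pos floor_less_iff[of "t / T" 1] by simp

lemma idx_bounds:
  assumes "0 \<le> t" shows "real (idx t) * T \<le> t" "t < real (Suc (idx t)) * T"
proof -
  define z where "z = \<lfloor>t / T\<rfloor>"
  have "real (idx t) = of_int z"
    unfolding idx_def z_def using T_pos assms by simp
  moreover have "of_int z \<le> t / T" "t / T < of_int z + 1"
    unfolding z_def by linarith+
  ultimately show "real (idx t) * T \<le> t" "t < real (Suc (idx t)) * T"
    using T_pos by (simp_all add: pos_le_divide_eq pos_divide_less_eq add.commute)
qed

lemma idx_upper: "t < real (Suc (idx t)) * T"
proof (cases "0 \<le> t")
  case False
  then show ?thesis using T_pos by (smt (verit) mult_nonneg_nonneg of_nat_0_le_iff)
qed (use idx_bounds in auto)

text \<open>Near any time the glued function is one fixed piece, so differentiability and continuity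
  pass from the pieces to it. The radius depends on the time only: to the right one stays before the
  next joint, to the left one may cross the previous joint by less than \<delta>, where
  \<open>compat\<close> identifies both pieces.\<close>

lemma glue_local:
  "\<exists>d>0. \<forall>F q. compat F \<longrightarrow> \<bar>tc q - t\<bar> < d \<longrightarrow> glue F q = F (idx t) q"
proof -
  define n where "n = idx t"
  define d where "d = min \<delta> (real (Suc n) * T - t)"
  have "d > 0" using T idx_upper[of t] by (simp add: d_def n_def)
  moreover have "glue F q = F n q" if F: "compat F" and q: "\<bar>tc q - t\<bar> < d" for F q
  proof (cases "real n * T \<le> tc q")
    case True
    then have "idx (tc q) = n" using q by (intro idx_eq) (auto simp: d_def)
    then show ?thesis by (simp add: glue_def)
  next
    case False
    show ?thesis
    proof (cases n)
      case 0
      then show ?thesis using False T_pos idx_0[of "tc q"] by (simp add: glue_def)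
    next
      case (Suc m)
      have "0 \<le> t" using Suc unfolding n_def idx_def using T_pos
        by (metis divide_less_0_iff floor_less_zero nat_eq_iff2 less_eq_real_def linorder_not_le nat.distinct(1) nat_0_iff)
      then have "real n * T \<le> t" using idx_bounds unfolding n_def by blast
      then have *: "real n * T - \<delta> < tc q" using q by (auto simp: d_def)
      then have "idx (tc q) = m"
        using False T Suc by (intro idx_eq) (auto simp: algebra_simps)
      moreover have "F m q = F (Suc m) q"
        by (rule F[unfolded compat_def, rule_format])
          (use * False Suc T in \<open>simp add: abs_if\<close>)
      ultimately show ?thesis using Suc by (simp add: glue_def)
    qed
  qed
  ultimately show ?thesis unfolding n_def by blast
qed

text \<open>Pieces that agree on an open band of times have equal derivatives there, by uniqueness
  of the derivative. Compatibility thus has to be computed only for the solution and the matrix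
  themselves.\<close>

lemma compat_hasD:
  assumes "compat F" "\<And>n. hasD i (F n) (F' n)"
  shows "compat F'"
  unfolding compat_def
proof (intro allI impI)
  fix n p assume p: "\<bar>tc p - real (Suc n) * T\<bar> < \<delta>"
  define e where "e = \<delta> - \<bar>tc p - real (Suc n) * T\<bar>"
  have "e > 0" using p by (simp add: e_def)
  then have "\<forall>\<^sub>F s in nhds 0. s \<in> {-e<..<e}" by (intro eventually_nhds_in_open) auto
  then have "\<forall>\<^sub>F s in nhds 0. F n (p + s *\<^sub>R ev i) = F (Suc n) (p + s *\<^sub>R ev i)"
  proof eventually_elim
    case (elim s)
    have "\<bar>tc (p + s *\<^sub>R ev i) - real (Suc n) * T\<bar> < \<delta>"
      using elim p by (auto simp: ev_simps e_def)
    then show ?case using assms(1) unfolding compat_def by blast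
  qed
  then have "((\<lambda>s. F (Suc n) (p + s *\<^sub>R ev i)) has_real_derivative F' n p) (at 0)"
    using assms(2)[of n] unfolding hasD_def
    by (subst DERIV_cong_ev[OF refl _ refl, symmetric, where f = "\<lambda>s. F n (p + s *\<^sub>R ev i)"]) blast+
  then show "F' n p = F' (Suc n) p"
    using assms(2) unfolding hasD_def by (blast intro: DERIV_unique)
qed

lemma glue_hasD:
  assumes "compat F" "\<And>n. hasD i (F n) (F' n)"
  shows "hasD i (glue F) (glue F')"
  unfolding hasD_def
proof
  fix p
  obtain d where d: "d > 0" "\<And>q. \<bar>tc q - tc p\<bar> < d \<Longrightarrow> glue F q = F (idx (tc p)) q"
    using glue_local[of "tc p"] assms(1) by blast
  have "\<forall>\<^sub>F s in nhds 0. s \<in> {-d<..<d}" using d(1) by (intro eventually_nhds_in_open) auto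
  then have "\<forall>\<^sub>F s in nhds 0. glue F (p + s *\<^sub>R ev i) = F (idx (tc p)) (p + s *\<^sub>R ev i)"
    by eventually_elim (auto intro!: d simp: ev_simps)
  then show "((\<lambda>s. glue F (p + s *\<^sub>R ev i)) has_real_derivative glue F' p) (at 0)"
    using assms(2)[of "idx (tc p)"] unfolding hasD_def glue_def[of F' p]
    by (subst DERIV_cong_ev[OF refl _ refl, where g = "\<lambda>s. F (idx (tc p)) (p + s *\<^sub>R ev i)"]) blast+
qed

lemma glue_continuous:
  assumes "compat F" "\<And>n. continuous_on UNIV (F n)"
  shows "continuous_on UNIV (glue F)"
proof (rule continuous_at_imp_continuous_on, rule ballI)
  fix p
  obtain d where d: "d > 0" "\<And>q. \<bar>tc q - tc p\<bar> < d \<Longrightarrow> glue F q = F (idx (tc p)) q"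
    using glue_local[of "tc p"] assms(1) by blast
  have "open {q::pt. \<bar>tc q - tc p\<bar> < d}"
    unfolding tc_def by (intro open_Collect_less continuous_intros)
  then have "\<forall>\<^sub>F q in nhds p. q \<in> {q. \<bar>tc q - tc p\<bar> < d}"
    using d(1) by (intro eventually_nhds_in_open) auto
  then have "\<forall>\<^sub>F q in nhds p. glue F q = F (idx (tc p)) q"
    by eventually_elim (auto intro: d)
  then have "isCont (glue F) p \<longleftrightarrow> isCont (F (idx (tc p))) p"
    by (rule isCont_cong)
  moreover have "isCont (F (idx (tc p))) p"
    using assms(2) continuous_on_eq_continuous_at[OF open_UNIV] by blast
  ultimately show "isCont (glue F) p" by blast
qed

end

subsection \<open>One frequency doubling\<close>

locale cascade = cutoff +
  fixes \<mu> :: real and k :: nat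
  assumes k_pos: "k > 0" and mu_k: "\<bar>\<mu>\<bar> / real k ^ 2 \<le> 1/1000"
begin

text \<open>Schedule of a step of length \<open>6*L\<close>: nothing on \<open>[0,L]\<close>, the
  yy-entry is lowered on \<open>[L,2*L]\<close>, the y-mode enters on \<open>[2*L,3*L]\<close>, the
  x-mode leaves on \<open>[3*L,4*L]\<close>, the decay accelerates on \<open>[4*L,5*L]\<close>,
  nothing on \<open>[5*L,6*L]\<close>. Accordingly the slope of \<open>phase\<close> grows from 1 to
  2 during the fifth interval.\<close>

definition phase :: "real \<Rightarrow> real" where "phase s = s + X (s - 4*L)"

definition \<alpha> where "\<alpha> K s = (1 - \<theta> (s - 3*L)) * exp (- K * s)"
definition \<alpha>1 where "\<alpha>1 K s = (- \<theta>1 (s - 3*L) - K * (1 - \<theta> (s - 3*L))) * exp (- K * s)"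
definition \<alpha>2 where "\<alpha>2 K s =
  (- \<theta>2 (s - 3*L) + 2*K*\<theta>1 (s - 3*L) + K^2 * (1 - \<theta> (s - 3*L))) * exp (- K * s)"

definition \<beta> where "\<beta> K s = \<theta> (s - 2*L) * exp (- K * phase s)"
definition \<beta>1 where "\<beta>1 K s =
  (\<theta>1 (s - 2*L) - K * (1 + \<theta> (s - 4*L)) * \<theta> (s - 2*L)) * exp (- K * phase s)"
definition \<beta>2 where "\<beta>2 K s =
  (\<theta>2 (s - 2*L) - 2*K*(1 + \<theta> (s - 4*L)) * \<theta>1 (s - 2*L)
    + (K^2 * (1 + \<theta> (s - 4*L))^2 - K * \<theta>1 (s - 4*L)) * \<theta> (s - 2*L)) * exp (- K * phase s)"

text \<open>Switching a cutoff on or off leaves an error that is a multiple of one cosine. It is removed by a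
  perturbation of the matrix in the single column that multiplies the derivative of the \<^emph>\<open>other\<close>
  mode: with \<open>F = - (h / K) (cos 2Ky cos Kx sin Kx, sin 2Ky (sin Kx)^2)\<close> one has
  \<open>div F = - h cos 2Ky\<close>, and both components of \<open>F\<close> are divisible by \<open>sin Kx\<close>, so that
  \<open>F\<close> is a smooth vector field times the x-derivative of \<open>exp (- K s) cos Kx\<close>. The
  resulting matrix is not symmetric.\<close>

definition \<gamma> where "\<gamma> c K s = (\<theta>2 (s - c*L) - 2*K*\<theta>1 (s - c*L)) / K^2"
definition \<gamma>1 where "\<gamma>1 c K s = (\<theta>3 (s - c*L) - 2*K*\<theta>2 (s - c*L)) / K^2"

text \<open>The next step has frequency \<open>2 * K\<close> and starts with off-mode entry 1 +
  \<mu>/(4(2K)^2) = 1 + \<mu>/(16 K^2), whence the 15/16. The change waits until the x-mode is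
  gone.\<close>

definition a0 where "a0 K s = 1 + \<mu>/K^2 * (1 - 15/16 * \<theta> (s - 4*L))"
definition a0' where "a0' K s = - (15/16 * (\<mu>/K^2) * \<theta>1 (s - 4*L))"
text \<open>Here \<open>1 + \<theta> (s - 4*L)\<close> is the derivative of \<open>phase\<close>, and the first summand is forced by the
  equation for \<open>exp (- K * phase s) cos 2Ky\<close>; the second one vanishes as soon as that mode is present.\<close>

definition a1 where "a1 K s =
  ((1 + \<theta> (s - 4*L))^2 - \<theta>1 (s - 4*L) / K + \<mu>/K^2) / 4 + 3/4 * (1 - \<theta> (s - L))"
definition a1' where "a1' K s =
  (2 * (1 + \<theta> (s - 4*L)) * \<theta>1 (s - 4*L) - \<theta>2 (s - 4*L) / K) / 4 - 3/4 * \<theta>1 (s - L)"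

lemma shift_deriv:
  assumes "\<And>s. (f has_real_derivative f' s) (at s)"
  shows "((\<lambda>s. f (s - c)) has_real_derivative f' (s - c)) (at s)"
proof -
  have "((\<lambda>s. s - c) has_real_derivative 1) (at s)"
    by (auto intro!: derivative_eq_intros)
  from DERIV_chain2[OF assms this] show ?thesis by simp
qed

lemmas theta_shift = deriv_theta[THEN shift_deriv]

lemma phase_deriv: "(phase has_real_derivative 1 + \<theta> (s - 4*L)) (at s)"
  unfolding phase_def[abs_def] by (auto intro!: derivative_eq_intros theta_shift)

lemma DERIV_cdivide_eq:
  "(f has_real_derivative D) (at x within S) \<Longrightarrow> D / c = E \<Longrightarrow>
    ((\<lambda>x. f x / c) has_real_derivative E) (at x within S)"
  using DERIV_cdivide by blast

lemma coeff_derivs: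
  "(\<alpha> K has_real_derivative \<alpha>1 K s) (at s)" "(\<alpha>1 K has_real_derivative \<alpha>2 K s) (at s)"
  "(\<beta> K has_real_derivative \<beta>1 K s) (at s)" "(\<beta>1 K has_real_derivative \<beta>2 K s) (at s)"
  "(\<gamma> c K has_real_derivative \<gamma>1 c K s) (at s)"
  "(a0 K has_real_derivative a0' K s) (at s)" "(a1 K has_real_derivative a1' K s) (at s)"
  unfolding \<alpha>_def[abs_def] \<alpha>1_def[abs_def] \<alpha>2_def \<beta>_def[abs_def] \<beta>1_def[abs_def] \<beta>2_def
    \<gamma>_def[abs_def] \<gamma>1_def a0_def[abs_def] a0'_def a1_def[abs_def] a1'_def
  by (rule DERIV_cdivide_eq derivative_eq_intros theta_shift phase_deriv refl | simp | simp add: algebra_simps power2_eq_square)+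

lemma theta_cont: "continuous_on UNIV \<theta>" "continuous_on UNIV \<theta>1" "continuous_on UNIV \<theta>2"
    "continuous_on UNIV X"
  using deriv_theta by (auto intro!: continuous_at_imp_continuous_on DERIV_isCont)

lemma coeff_cont:
  "continuous_on UNIV (\<alpha> K)" "continuous_on UNIV (\<alpha>1 K)" "continuous_on UNIV (\<alpha>2 K)"
  "continuous_on UNIV (\<beta> K)" "continuous_on UNIV (\<beta>1 K)" "continuous_on UNIV (\<beta>2 K)"
  "continuous_on UNIV (\<gamma> c K)" "continuous_on UNIV (\<gamma>1 c K)"
  "continuous_on UNIV (a0 K)" "continuous_on UNIV (a0' K)"
  "continuous_on UNIV (a1 K)" "continuous_on UNIV (a1' K)"
  unfolding \<alpha>_def[abs_def] \<alpha>1_def[abs_def] \<alpha>2_def[abs_def] \<beta>_def[abs_def] \<beta>1_def[abs_def] \<beta>2_def[abs_def]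
    \<gamma>_def[abs_def] \<gamma>1_def[abs_def] a0_def[abs_def] a0'_def[abs_def] a1_def[abs_def] a1'_def[abs_def]
    phase_def divide_inverse
  by (intro continuous_intros continuous_on_compose2[OF theta_cont(1)] continuous_on_compose2[OF theta_cont(2)]
      continuous_on_compose2[OF theta_cont(3)] continuous_on_compose2[OF theta_cont(4)]
      continuous_on_compose2[OF cont_theta3]; simp)+

lemma phase_nonneg: "0 \<le> s \<Longrightarrow> 0 \<le> phase s"
  using X_nonneg by (simp add: phase_def)

lemma abs_mult_le: "\<bar>x\<bar> \<le> a \<Longrightarrow> \<bar>y\<bar> \<le> b \<Longrightarrow> \<bar>x * y\<bar> \<le> a * b" for x y a b :: real
  unfolding abs_mult by (rule mult_mono) auto

lemma abs_theta:
  "\<bar>\<theta> s\<bar> \<le> 1" "\<bar>1 - \<theta> s\<bar> \<le> 1" "\<bar>1 + \<theta> s\<bar> \<le> 2" "\<bar>(1 + \<theta> s)^2\<bar> \<le> 4"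
  "\<bar>1 - 15/16 * \<theta> s\<bar> \<le> 1"
proof -
  show 1: "\<bar>\<theta> s\<bar> \<le> 1" "\<bar>1 - \<theta> s\<bar> \<le> 1" "\<bar>1 + \<theta> s\<bar> \<le> 2" "\<bar>1 - 15/16 * \<theta> s\<bar> \<le> 1"
    using theta_range[of s] by auto
  show "\<bar>(1 + \<theta> s)^2\<bar> \<le> 4"
    using abs_mult_le[OF 1(3) 1(3)] by (simp add: power2_eq_square)
qed

lemma K_square: "1 \<le> K \<Longrightarrow> 1 \<le> K^2" "1 \<le> K \<Longrightarrow> K \<le> K^2" for K :: real
  by (auto intro: one_le_power self_le_power)

text \<open>For nonnegative local time both exponentials are at most 1, so only the polynomial
  prefactors in \<open>K\<close> have to be estimated.\<close>

lemma coeff_bounds: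
  assumes K: "1 \<le> K" and s: "0 \<le> s"
  shows "\<bar>\<alpha> K s\<bar> \<le> 1" "\<bar>\<alpha>1 K s\<bar> \<le> 2*K" "\<bar>\<alpha>2 K s\<bar> \<le> 2*K^2"
    "\<bar>\<beta> K s\<bar> \<le> 1" "\<bar>\<beta>1 K s\<bar> \<le> 3*K" "\<bar>\<beta>2 K s\<bar> \<le> 6*K^2"
proof -
  have e: "\<bar>x * exp (- K * s)\<bar> \<le> M" "\<bar>x * exp (- K * phase s)\<bar> \<le> M" if "\<bar>x\<bar> \<le> M" for x M
    using abs_mult_le[OF that, of "exp (- K * s)" 1] abs_mult_le[OF that, of "exp (- K * phase s)" 1]
      K s phase_nonneg[OF s] by simp_all
  note KK = K_square[OF K]
  have k: "\<bar>K\<bar> \<le> K" "\<bar>K^2\<bar> \<le> K^2" using K by auto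
  let ?a = "\<theta> (s - 3*L)" let ?b = "\<theta> (s - 2*L)" let ?d = "\<theta> (s - 4*L)"
  let ?a1 = "\<theta>1 (s - 3*L)" let ?b1 = "\<theta>1 (s - 2*L)" let ?d1 = "\<theta>1 (s - 4*L)"
  have q: "\<bar>?a1\<bar> \<le> 1/100" "\<bar>?b1\<bar> \<le> 1/100" "\<bar>\<theta>2 (s - 3*L)\<bar> \<le> 1/100" "\<bar>\<theta>2 (s - 2*L)\<bar> \<le> 1/100"
    by (rule theta_small)+
  have m: "\<bar>K * (1 - ?a)\<bar> \<le> K * 1" "\<bar>K^2 * (1 - ?a)\<bar> \<le> K^2 * 1" "\<bar>K * ?a1\<bar> \<le> K * (1/100)"
    "\<bar>K * (1 + ?d) * ?b\<bar> \<le> K * 2 * 1" "\<bar>K * (1 + ?d) * ?b1\<bar> \<le> K * 2 * (1/100)"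
    "\<bar>K * ?d1 * ?b\<bar> \<le> K * (1/100) * 1" "\<bar>K^2 * (1 + ?d)^2 * ?b\<bar> \<le> K^2 * 4 * 1"
    by (intro abs_mult_le k theta_small abs_theta)+
  note f = m[unfolded abs_le_iff] q[unfolded abs_le_iff]
  show "\<bar>\<alpha> K s\<bar> \<le> 1" "\<bar>\<beta> K s\<bar> \<le> 1"
    unfolding \<alpha>_def \<beta>_def by (intro e abs_theta)+
  show "\<bar>\<alpha>1 K s\<bar> \<le> 2*K" unfolding \<alpha>1_def by (rule e, rule abs_leI) (use f K in linarith)+
  show "\<bar>\<alpha>2 K s\<bar> \<le> 2*K^2" unfolding \<alpha>2_def by (rule e, rule abs_leI) (use f K KK in linarith)+
  show "\<bar>\<beta>1 K s\<bar> \<le> 3*K" unfolding \<beta>1_def by (rule e, rule abs_leI) (use f K in linarith)+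
  show "\<bar>\<beta>2 K s\<bar> \<le> 6*K^2" unfolding \<beta>2_def left_diff_distrib[of "K^2 * (1 + ?d)^2"]
    by (rule e, rule abs_leI) (use f K KK in linarith)+
qed

text \<open>The correction is of order 1/K because its numerator is at most linear in
  \<open>K\<close>. A space derivative costs a factor of order \<open>K\<close>, so the Lipschitz
  bound survives all frequency doublings.\<close>

lemma gamma_bounds:
  assumes K: "1 \<le> K"
  shows "\<bar>\<gamma> c K s\<bar> \<le> 3/100" "\<bar>K * \<gamma> c K s\<bar> \<le> 3/100" "\<bar>\<gamma>1 c K s\<bar> \<le> 3/100"
proof -
  note KK = K_square[OF K]
  have k: "\<bar>K\<bar> \<le> K" "\<bar>K^2\<bar> \<le> K^2" using K by auto
  note q = theta_small[of "s - c*L", unfolded abs_le_iff]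
  have m: "\<bar>K * \<theta>1 (s - c*L)\<bar> \<le> K * (1/100)" "\<bar>K * \<theta>2 (s - c*L)\<bar> \<le> K * (1/100)"
    "\<bar>K^2 * \<theta>1 (s - c*L)\<bar> \<le> K^2 * (1/100)"
    by (intro abs_mult_le k theta_small)+
  note f = m[unfolded abs_le_iff] q
  have 1: "\<bar>x / K^2\<bar> \<le> 3/100" if "\<bar>x\<bar> \<le> 3/100 * K^2" for x
  proof -
    have "\<bar>x\<bar> / K^2 \<le> 3/100" using that KK(1) by (subst pos_divide_le_eq) auto
    then show ?thesis by simp
  qed
  show "\<bar>\<gamma> c K s\<bar> \<le> 3/100" unfolding \<gamma>_def by (rule 1, rule abs_leI) (use f KK in linarith)+
  show "\<bar>\<gamma>1 c K s\<bar> \<le> 3/100" unfolding \<gamma>1_def by (rule 1, rule abs_leI) (use f KK in linarith)+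
  have "K * \<gamma> c K s = (K * \<theta>2 (s - c*L) - 2 * (K^2 * \<theta>1 (s - c*L))) / K^2"
    unfolding \<gamma>_def by (simp add: algebra_simps power2_eq_square)
  moreover have "\<bar>\<dots>\<bar> \<le> 3/100" by (rule 1, rule abs_leI) (use f KK in linarith)+
  ultimately show "\<bar>K * \<gamma> c K s\<bar> \<le> 3/100" by simp
qed

lemma a_bounds:
  assumes K: "1 \<le> K" and mu: "\<bar>\<mu>\<bar> / K^2 \<le> 1/1000"
  shows "9/10 \<le> a0 K s" "a0 K s \<le> 2" "1/5 \<le> a1 K s" "a1 K s \<le> 2"
    "\<bar>a0' K s\<bar> \<le> 1" "\<bar>a1' K s\<bar> \<le> 1"
proof -
  note r = theta_range[of "s - L"] theta_range[of "s - 4*L"]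
  have mu': "\<bar>\<mu> / K^2\<bar> \<le> 1/1000" using mu by simp
  have i: "\<bar>\<theta>1 (s - 4*L) / K\<bar> \<le> 1/100" "\<bar>\<theta>2 (s - 4*L) / K\<bar> \<le> 1/100"
    unfolding divide_inverse[of _ K]
    using abs_mult_le[OF theta_small(1), of "inverse K" 1] abs_mult_le[OF theta_small(2), of "inverse K" 1] K
    by (simp_all add: inverse_le_1_iff)
  have m: "\<bar>\<mu>/K^2 * (1 - 15/16 * \<theta> (s - 4*L))\<bar> \<le> 1/1000 * 1"
    "\<bar>\<mu>/K^2 * \<theta>1 (s - 4*L)\<bar> \<le> 1/1000 * (1/100)"
    "\<bar>(1 + \<theta> (s - 4*L)) * \<theta>1 (s - 4*L)\<bar> \<le> 2 * (1/100)"
    by (intro abs_mult_le mu' theta_small abs_theta)+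
  define z where "z = (1 + \<theta> (s - 4*L))^2"
  have "1^2 \<le> z" "z \<le> 2^2"
    unfolding z_def using r by (intro power_mono; simp)+
  then have p: "1 \<le> z" "z \<le> 4" by simp_all
  note f = m[unfolded abs_le_iff] i[unfolded abs_le_iff] mu'[unfolded abs_le_iff]
    theta_small(1)[of "s - L", unfolded abs_le_iff]
  show "9/10 \<le> a0 K s" "a0 K s \<le> 2" unfolding a0_def using f by linarith+
  have "1/5 \<le> (z - u + v) / 4 + 3/4 * (1 - w)" "(z - u + v) / 4 + 3/4 * (1 - w) \<le> 2"
    if "\<bar>u\<bar> \<le> 1/100" "\<bar>v\<bar> \<le> 1/1000" "0 \<le> w" "w \<le> 1" for u v w :: real
    using that p by (simp_all add: abs_le_iff field_simps)
  from this[OF i(1) mu' r(1,2)] show "1/5 \<le> a1 K s" "a1 K s \<le> 2"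
    unfolding a1_def z_def by auto
  show "\<bar>a0' K s\<bar> \<le> 1" unfolding a0'_def by (rule abs_leI) (use f in linarith)+
  have "\<bar>(2 * u - v) / 4 - 3/4 * w\<bar> \<le> 1"
    if "\<bar>u\<bar> \<le> 2 * (1/100)" "\<bar>v\<bar> \<le> 1/100" "\<bar>w\<bar> \<le> 1/100" for u v w :: real
    using that unfolding abs_le_iff by (simp add: field_simps)
  from this[OF m(3) i(2) theta_small(1)[of "s - L"]] show "\<bar>a1' K s\<bar> \<le> 1"
    unfolding a1'_def by (simp only: mult.assoc)
qed

section \<open>Solution and matrix of one step, with their derivatives\<close>

abbreviation "nsin \<equiv> (\<lambda>z::real. - sin z)"
abbreviation "ncos \<equiv> (\<lambda>z::real. - cos z)"
abbreviation "zero \<equiv> (\<lambda>_::real. 0::real)"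

definition W :: "real \<Rightarrow> pt \<Rightarrow> real" where
  "W K = modes K (\<alpha> K) cos (\<beta> K) cos"

definition W1 :: "real \<Rightarrow> nat \<Rightarrow> pt \<Rightarrow> real" where
  "W1 K i = (if i = 0 then modes K (\<lambda>s. K * \<alpha> K s) nsin zero cos
     else if i = 1 then modes K zero cos (\<lambda>s. 2 * K * \<beta> K s) nsin
     else modes K (\<alpha>1 K) cos (\<beta>1 K) cos)"

text \<open>The mixed xy-derivatives are zero; they are written as modes of zero amplitude so that
  the rules for \<open>modes\<close> cover every case.\<close>

definition W2 :: "real \<Rightarrow> nat \<Rightarrow> nat \<Rightarrow> pt \<Rightarrow> real" where
  "W2 K i j =
    (if i = 0 then
      (if j = 0 then modes K (\<lambda>s. K^2 * \<alpha> K s) ncos zero cos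
       else if j = 1 then modes K zero cos zero nsin
       else modes K (\<lambda>s. K * \<alpha>1 K s) nsin zero cos)
     else if i = 1 then
      (if j = 0 then modes K zero nsin zero cos
       else if j = 1 then modes K zero cos (\<lambda>s. 4 * K^2 * \<beta> K s) ncos
       else modes K zero cos (\<lambda>s. 2 * K * \<beta>1 K s) nsin)
     else
      (if j = 0 then modes K (\<lambda>s. K * \<alpha>1 K s) nsin zero cos
       else if j = 1 then modes K zero cos (\<lambda>s. 2 * K * \<beta>1 K s) nsin
       else modes K (\<alpha>2 K) cos (\<beta>2 K) cos))"

text \<open>The first column, which meets the x-derivative, repairs the entry of the y-mode
  (\<open>\<gamma> 2\<close>); the second repairs the exit of the x-mode
  (\<open>\<gamma> 3\<close>). The weight 1/4 is the inverse square of the frequency ratio 2 and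
  lets sin^2 and cos^2 add up to 1 in the divergence.\<close>

definition B :: "real \<Rightarrow> nat \<Rightarrow> nat \<Rightarrow> pt \<Rightarrow> real" where
  "B K i j =
    (if i = 0 then
      (if j = 0 then prodmode K (a0 K) (\<gamma> 2 K) cos cos else prodmode K zero (\<lambda>s. - \<gamma> 3 K s) sin sin)
     else
      (if j = 0 then prodmode K zero (\<gamma> 2 K) sin sin
       else prodmode K (a1 K) (\<lambda>s. - \<gamma> 3 K s / 4) cos cos))"

definition B1 :: "real \<Rightarrow> nat \<Rightarrow> nat \<Rightarrow> nat \<Rightarrow> pt \<Rightarrow> real" where
  "B1 K i j l =
    (if i = 0 then
      (if j = 0 then
        (if l = 0 then prodmode K zero (\<lambda>s. K * \<gamma> 2 K s) nsin cos
         else if l = 1 then prodmode K zero (\<lambda>s. 2 * K * \<gamma> 2 K s) cos nsin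
         else prodmode K (a0' K) (\<gamma>1 2 K) cos cos)
       else
        (if l = 0 then prodmode K zero (\<lambda>s. - (K * \<gamma> 3 K s)) cos sin
         else if l = 1 then prodmode K zero (\<lambda>s. - (2 * K * \<gamma> 3 K s)) sin cos
         else prodmode K zero (\<lambda>s. - \<gamma>1 3 K s) sin sin))
     else
      (if j = 0 then
        (if l = 0 then prodmode K zero (\<lambda>s. K * \<gamma> 2 K s) cos sin
         else if l = 1 then prodmode K zero (\<lambda>s. 2 * K * \<gamma> 2 K s) sin cos
         else prodmode K zero (\<gamma>1 2 K) sin sin)
       else
        (if l = 0 then prodmode K zero (\<lambda>s. - (K * \<gamma> 3 K s / 4)) nsin cos
         else if l = 1 then prodmode K zero (\<lambda>s. - (K * \<gamma> 3 K s / 2)) cos nsin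
         else prodmode K (a1' K) (\<lambda>s. - \<gamma>1 3 K s / 4) cos cos)))"

lemma trig_derivs:
  "(sin has_real_derivative cos z) (at z)" "(cos has_real_derivative nsin z) (at z)"
  "(nsin has_real_derivative ncos z) (at z)"
  by (auto intro!: derivative_eq_intros)

lemma less3: "i < 3 \<Longrightarrow> i = 0 \<or> i = Suc 0 \<or> i = (2::nat)" by auto

lemma W_hasD: "i < 3 \<Longrightarrow> hasD i (W K) (W1 K i)"
  unfolding W_def W1_def
  by (drule less3) (auto intro!: hasD_modes trig_derivs coeff_derivs)

lemma W1_hasD: "i < 3 \<Longrightarrow> j < 3 \<Longrightarrow> hasD j (W1 K i) (W2 K i j)"
  unfolding W1_def W2_def
  by (drule less3, drule less3)
    (auto intro!: hasD_modes trig_derivs coeff_derivs DERIV_const DERIV_cmult simp: power2_eq_square)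

lemma B_hasD: "i < 2 \<Longrightarrow> j < 2 \<Longrightarrow> l < 3 \<Longrightarrow> hasD l (B K i j) (B1 K i j l)"
  unfolding B_def B1_def
  by (drule less3)
    (auto intro!: hasD_prodmode trig_derivs coeff_derivs DERIV_const DERIV_cdivide DERIV_minus)

lemma trig_cont: "continuous_on UNIV (sin::real\<Rightarrow>real)" "continuous_on UNIV (cos::real\<Rightarrow>real)"
  "continuous_on UNIV nsin" "continuous_on UNIV ncos"
  by (intro continuous_intros)+

lemma W_cont: "continuous_on UNIV (W K)" "continuous_on UNIV (W1 K i)" "continuous_on UNIV (W2 K i j)"
  "continuous_on UNIV (B K i j)" "continuous_on UNIV (B1 K i j l)"
  unfolding W_def W1_def W2_def B_def B1_def
  by (auto intro!: continuous_modes continuous_prodmode trig_cont coeff_cont continuous_intros)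

text \<open>These are the coefficients of cos Kx and cos 2Ky in the equation. The cutoff errors can
  be expressed through the other mode because both decay like \<open>exp (- K * s)\<close> while
  either cutoff acts.\<close>

lemma ode:
  assumes K: "1 \<le> K"
  shows "\<alpha>2 K s = (a0 K s * K^2 - \<mu>) * \<alpha> K s - K^2 * \<gamma> 3 K s * \<beta> K s"
    and "\<beta>2 K s = (4 * K^2 * a1 K s - \<mu>) * \<beta> K s + K^2 * \<gamma> 2 K s * \<alpha> K s"
proof -
  have K0: "K \<noteq> 0" using K by simp
  have g: "K^2 * \<gamma> c K s = \<theta>2 (s - c*L) - 2*K*\<theta>1 (s - c*L)" for c
    unfolding \<gamma>_def using K0 by simp
  have a0: "a0 K s * K^2 - \<mu> = K^2 - 15/16 * \<mu> * \<theta> (s - 4*L)"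
    unfolding a0_def using K0 by (simp add: field_simps)
  have a1: "4 * K^2 * a1 K s - \<mu> =
      (1 + \<theta> (s - 4*L))^2 * K^2 - K * \<theta>1 (s - 4*L) + 3 * K^2 * (1 - \<theta> (s - L))"
    unfolding a1_def using K0 by (simp add: field_simps power2_eq_square)
  \<comment> \<open>In turn: only the x-mode; the x-mode is exactly \<open>exp (- K * s)\<close> and
    feeds the entering one; the y-mode is exactly \<open>exp (- K * s)\<close> and feeds the leaving
    one; only the y-mode, which \<open>a1\<close> solves exactly.\<close>
  consider "s \<le> 2*L" | "2*L \<le> s" "s \<le> 3*L" | "3*L \<le> s" "s \<le> 4*L" | "4*L \<le> s" by linarith
  then have "\<alpha>2 K s = (a0 K s * K^2 - \<mu>) * \<alpha> K s - K^2 * \<gamma> 3 K s * \<beta> K s \<and>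
    \<beta>2 K s = (4 * K^2 * a1 K s - \<mu>) * \<beta> K s + K^2 * \<gamma> 2 K s * \<alpha> K s"
  proof cases
    case 1
    then show ?thesis
      using before[of "s - 2*L"] before[of "s - 3*L"] before[of "s - 4*L"] ell
      unfolding g a0 a1 by (simp add: \<alpha>_def \<alpha>2_def \<beta>_def \<beta>2_def)
  next
    case 2
    then show ?thesis
      using after[of "s - L"] before[of "s - 3*L"] before[of "s - 4*L"] ell
      unfolding g a0 a1 by (simp add: \<alpha>_def \<alpha>2_def \<beta>_def \<beta>2_def phase_def algebra_simps)
  next
    case 3
    then show ?thesis
      using after[of "s - L"] after[of "s - 2*L"] before[of "s - 4*L"] ell
      unfolding g a0 a1 by (simp add: \<alpha>_def \<alpha>2_def \<beta>_def \<beta>2_def phase_def algebra_simps)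
  next
    case 4
    then show ?thesis
      using after[of "s - L"] after[of "s - 2*L"] after[of "s - 3*L"] ell
      unfolding g a0 a1 by (simp add: \<alpha>_def \<alpha>2_def \<beta>_def \<beta>2_def algebra_simps)
  qed
  then show "\<alpha>2 K s = (a0 K s * K^2 - \<mu>) * \<alpha> K s - K^2 * \<gamma> 3 K s * \<beta> K s"
    "\<beta>2 K s = (4 * K^2 * a1 K s - \<mu>) * \<beta> K s + K^2 * \<gamma> 2 K s * \<alpha> K s" by auto
qed

lemma sum2: "(\<Sum>i<2. f i) = f 0 + f (Suc 0)" for f :: "nat \<Rightarrow> real"
  by (simp add: numeral_2_eq_2)

text \<open>The \<gamma>-terms of the divergence collect into multiples of sin^2 + cos^2, so no
  harmonics beyond the two modes remain and \<open>ode\<close> finishes.\<close>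

lemma step_pde:
  assumes K: "1 \<le> K"
  shows "W2 K 2 2 p + (\<Sum>i<2. \<Sum>j<2. B1 K i j i p * W1 K j p + B K i j p * W2 K j i p) = - \<mu> * W K p"
proof -
  define cx sx cy sy where "cx = cos (K * fst p)" and "sx = sin (K * fst p)"
    and "cy = cos (2 * K * fst (snd p))" and "sy = sin (2 * K * fst (snd p))"
  define s where "s = tc p"
  have sq: "sx^2 = 1 - cx^2" "sy^2 = 1 - cy^2"
    unfolding cx_def sx_def cy_def sy_def by (simp_all add: sin_squared_eq)
  have "W2 K 2 2 p + (\<Sum>i<2. \<Sum>j<2. B1 K i j i p * W1 K j p + B K i j p * W2 K j i p)
     = \<alpha>2 K s * cx + \<beta>2 K s * cy - a0 K s * K^2 * \<alpha> K s * cx - 4 * K^2 * a1 K s * \<beta> K s * cy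
       - K^2 * \<gamma> 2 K s * \<alpha> K s * cy * (sx^2 + cx^2) + K^2 * \<gamma> 3 K s * \<beta> K s * cx * (sy^2 + cy^2)"
    unfolding sum2 W1_def W2_def B_def B1_def
    by (simp add: modes_def prodmode_def cx_def[symmetric] sx_def[symmetric] cy_def[symmetric] sy_def[symmetric]
      s_def[symmetric] power2_eq_square) (simp add: algebra_simps)
  also have "\<dots> = - \<mu> * W K p"
    unfolding ode[OF K] sq W_def modes_def cx_def[symmetric] cy_def[symmetric] s_def[symmetric]
    by (simp add: algebra_simps)
  finally show ?thesis .
qed

section \<open>Size, ellipticity and Lipschitz bounds on one step\<close>

lemma step_bounds:
  assumes K: "1 \<le> K" and s: "0 \<le> tc p"
  shows "\<bar>W K p\<bar> \<le> 2" "\<bar>W1 K i p\<bar> \<le> 12 * K^2" "\<bar>W2 K i j p\<bar> \<le> 12 * K^2"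
proof -
  note KK = K_square[OF K] and c = coeff_bounds[OF K s]
  have K0: "0 \<le> K" using K by simp
  show "\<bar>W K p\<bar> \<le> 2"
    unfolding W_def using modes_bound[of "\<alpha> K" p 1 "\<beta> K" cos cos] c by simp
  have k: "\<bar>K\<bar> \<le> K" "\<bar>K^2\<bar> \<le> K^2" "\<bar>2*K\<bar> \<le> 2*K" "\<bar>4*K^2\<bar> \<le> 4*K^2" using K by auto
  let ?s = "tc p"
  have a: "\<bar>K * \<alpha> K ?s\<bar> \<le> K * 1" "\<bar>K^2 * \<alpha> K ?s\<bar> \<le> K^2 * 1" "\<bar>K * \<alpha>1 K ?s\<bar> \<le> K * (2*K)"
    "\<bar>2*K * \<beta> K ?s\<bar> \<le> 2*K * 1" "\<bar>4*K^2 * \<beta> K ?s\<bar> \<le> 4*K^2 * 1" "\<bar>2*K * \<beta>1 K ?s\<bar> \<le> 2*K * (3*K)"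
    by (intro abs_mult_le k c)+
  \<comment> \<open>As \<open>K\<close> is at least 1, every amplitude fits under the common bound
    \<open>6 * K^2\<close>; two modes give \<open>12 * K^2\<close>.\<close>
  have a: "\<bar>K * \<alpha> K ?s\<bar> \<le> 6 * K^2" "\<bar>K^2 * \<alpha> K ?s\<bar> \<le> 6 * K^2" "\<bar>K * \<alpha>1 K ?s\<bar> \<le> 6 * K^2"
    "\<bar>2*K * \<beta> K ?s\<bar> \<le> 6 * K^2" "\<bar>4*K^2 * \<beta> K ?s\<bar> \<le> 6 * K^2" "\<bar>2*K * \<beta>1 K ?s\<bar> \<le> 6 * K^2"
    "\<bar>\<alpha>1 K ?s\<bar> \<le> 6 * K^2" "\<bar>\<beta>1 K ?s\<bar> \<le> 6 * K^2" "\<bar>\<alpha>2 K ?s\<bar> \<le> 6 * K^2" "\<bar>\<beta>2 K ?s\<bar> \<le> 6 * K^2"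
    "\<bar>0::real\<bar> \<le> 6 * K^2"
    by (rule order.trans[OF a(1)] order.trans[OF a(2)] order.trans[OF a(3)] order.trans[OF a(4)]
       order.trans[OF a(5)] order.trans[OF a(6)] order.trans[OF c(2)] order.trans[OF c(3)]
       order.trans[OF c(5)] order.trans[OF c(6)], use KK K0 in \<open>simp add: power2_eq_square[symmetric]\<close>)+ simp
  have m: "\<bar>modes K f \<phi> g \<psi> p\<bar> \<le> 12 * K^2"
    if "\<bar>f ?s\<bar> \<le> 6 * K^2" "\<bar>g ?s\<bar> \<le> 6 * K^2" "\<And>z. \<bar>\<phi> z\<bar> \<le> 1" "\<And>z. \<bar>\<psi> z\<bar> \<le> 1" for f g \<phi> \<psi>
    using modes_bound[where a = f and b = g and M = "6 * K^2" and \<phi> = \<phi> and \<psi> = \<psi>] that by auto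
  show "\<bar>W1 K i p\<bar> \<le> 12 * K^2" "\<bar>W2 K i j p\<bar> \<le> 12 * K^2"
    unfolding W1_def W2_def by (auto simp del: abs_mult abs_zero intro!: m a)
qed

lemma B_bounds:
  assumes K: "1 \<le> K" and mu: "\<bar>\<mu>\<bar> / K^2 \<le> 1/1000"
  shows "8/10 \<le> B K 0 0 p" "B K 0 0 p \<le> 3" "1/10 \<le> B K (Suc 0) (Suc 0) p" "B K (Suc 0) (Suc 0) p \<le> 3"
    "\<bar>B K 0 (Suc 0) p\<bar> \<le> 3/100" "\<bar>B K (Suc 0) 0 p\<bar> \<le> 3/100" "\<bar>B1 K i j l p\<bar> \<le> 61"
proof -
  note g = gamma_bounds[OF K] and a = a_bounds[OF K mu]
  have b: "\<bar>prodmode K m h \<phi> \<psi> p - m (tc p)\<bar> \<le> 6/100"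
    if "\<bar>h (tc p)\<bar> \<le> 6/100" "\<And>z. \<bar>\<phi> z\<bar> \<le> 1" "\<And>z. \<bar>\<psi> z\<bar> \<le> 1" for m h \<phi> \<psi>
    by (rule prodmode_bound) (use that in auto)
  have b0: "\<bar>prodmode K zero h \<phi> \<psi> p\<bar> \<le> 3/100"
    if "\<bar>h (tc p)\<bar> \<le> 3/100" "\<And>z. \<bar>\<phi> z\<bar> \<le> 1" "\<And>z. \<bar>\<psi> z\<bar> \<le> 1" for h \<phi> \<psi>
    using prodmode_bound[of h p "3/100" \<phi> \<psi> K zero] that by auto
  have h: "\<bar>\<gamma> 2 K (tc p)\<bar> \<le> 6/100" "\<bar>- \<gamma> 3 K (tc p) / 4\<bar> \<le> 6/100"
    using g(1)[of 2 "tc p"] g(1)[of 3 "tc p"] by auto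
  have B: "\<bar>B K 0 0 p - a0 K (tc p)\<bar> \<le> 6/100" "\<bar>B K (Suc 0) (Suc 0) p - a1 K (tc p)\<bar> \<le> 6/100"
    using b[of "\<gamma> 2 K" cos cos "a0 K"] b[of "\<lambda>s. - \<gamma> 3 K s / 4" cos cos "a1 K"] h
    by (simp_all add: B_def)
  show "8/10 \<le> B K 0 0 p" "B K 0 0 p \<le> 3" "1/10 \<le> B K (Suc 0) (Suc 0) p" "B K (Suc 0) (Suc 0) p \<le> 3"
    using B[unfolded abs_le_iff] a(1-4)[of "tc p"] by simp_all
  show "\<bar>B K 0 (Suc 0) p\<bar> \<le> 3/100" "\<bar>B K (Suc 0) 0 p\<bar> \<le> 3/100"
    using b0[of "\<lambda>s. - \<gamma> 3 K s" sin sin] b0[of "\<gamma> 2 K" sin sin] g(1)[of _ "tc p"] by (simp_all add: B_def)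
  \<comment> \<open>The estimate obtained is 1 + 6/100, well below 61.\<close>
  have e: "\<bar>prodmode K m h \<phi> \<psi> p\<bar> \<le> 61"
    if "\<bar>h (tc p)\<bar> \<le> 6/100" "\<bar>m (tc p)\<bar> \<le> 1" "\<And>z. \<bar>\<phi> z\<bar> \<le> 1" "\<And>z. \<bar>\<psi> z\<bar> \<le> 1" for m h \<phi> \<psi>
  proof -
    have "\<bar>prodmode K m h \<phi> \<psi> p - m (tc p)\<bar> \<le> 6/100"
      by (rule b) (use that in auto)
    with that(2) show ?thesis by linarith
  qed
  have h1: "\<bar>K * \<gamma> d K (tc p)\<bar> \<le> 6/100" "\<bar>2 * K * \<gamma> d K (tc p)\<bar> \<le> 6/100"
    "\<bar>- (K * \<gamma> d K (tc p))\<bar> \<le> 6/100" "\<bar>- (2 * K * \<gamma> d K (tc p))\<bar> \<le> 6/100"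
    "\<bar>- (K * \<gamma> d K (tc p) / 4)\<bar> \<le> 6/100" "\<bar>- (K * \<gamma> d K (tc p) / 2)\<bar> \<le> 6/100" for d
    using g(2)[of d "tc p"] abs_mult_le[of 2 2, OF _ g(2)[of d "tc p"]] by (simp_all add: mult.assoc)
  have h2: "\<bar>\<gamma>1 d K (tc p)\<bar> \<le> 6/100" "\<bar>- \<gamma>1 d K (tc p)\<bar> \<le> 6/100" "\<bar>- \<gamma>1 d K (tc p) / 4\<bar> \<le> 6/100" for d
    using g(3)[of d "tc p"] by simp_all
  have m: "\<bar>0::real\<bar> \<le> 1" "\<bar>sin z\<bar> \<le> 1" "\<bar>cos z\<bar> \<le> 1" "\<bar>- sin z\<bar> \<le> 1" for z :: real
    by simp_all
  have if_bound: "\<bar>(if P then f else g) p\<bar> \<le> 61" if "\<bar>f p\<bar> \<le> 61" "\<bar>g p\<bar> \<le> 61" for P f g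
    using that by simp
  show "\<bar>B1 K i j l p\<bar> \<le> 61"
    unfolding B1_def by (intro if_bound e h1 h2 m a)
qed

text \<open>Only b + c enters the quadratic form, and |xy| is at most half of x^2 + y^2. The cross
  terms thus cost at most 3/100, less than the smallest diagonal bound 1/10.\<close>

lemma ellipticity:
  fixes a b c d x y :: real
  assumes "8/10 \<le> a" "a \<le> 3" "1/10 \<le> d" "d \<le> 3" "\<bar>b\<bar> \<le> 3/100" "\<bar>c\<bar> \<le> 3/100"
  shows "1/100 * (x^2 + y^2) \<le> x*a*x + x*b*y + (y*c*x + y*d*y)"
    "x*a*x + x*b*y + (y*c*x + y*d*y) \<le> 100 * (x^2 + y^2)"
proof -
  have "\<bar>(b + c) * (x * y)\<bar> \<le> (6/100) * ((x^2 + y^2) / 2)"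
    using zero_le_power2[of "x - y"] zero_le_power2[of "x + y"] assms(5,6)
    by (intro abs_mult_le abs_leI) (auto simp: power2_eq_square algebra_simps)
  moreover have "8/10 * x^2 \<le> a * x^2" "a * x^2 \<le> 3 * x^2" "1/10 * y^2 \<le> d * y^2" "d * y^2 \<le> 3 * y^2"
    using assms by (intro mult_right_mono; simp)+
  moreover have "x*a*x + x*b*y + (y*c*x + y*d*y) = a * x^2 + d * y^2 + (b + c) * (x * y)"
    by (simp add: algebra_simps power2_eq_square)
  ultimately show "1/100 * (x^2 + y^2) \<le> x*a*x + x*b*y + (y*c*x + y*d*y)"
    "x*a*x + x*b*y + (y*c*x + y*d*y) \<le> 100 * (x^2 + y^2)"
    using zero_le_power2[of x] zero_le_power2[of y] by (simp_all add: abs_le_iff)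
qed

section \<open>Passage from one step to the next\<close>

definition \<Gamma> :: real where "\<Gamma> = 8*L - \<kappa>"

text \<open>Nonnegativity of \<open>X L = L - \<kappa>\<close> gives \<kappa> \<le> L, hence
  \<Gamma> \<ge> 7L.\<close>

lemma Gamma_ge: "1 \<le> \<Gamma>"
  using after[of L] X_nonneg[of L] ell unfolding \<Gamma>_def by auto

text \<open>All cutoffs are constant near the joint: the old ones are finished, the new ones have
  not begun. The phase there is 2s + \<Gamma>, so the surviving mode is the starting mode of
  frequency \<open>2 * K\<close> with \<open>x\<close> and \<open>y\<close> exchanged, times a
  constant. The identity holds on a whole neighbourhood of the joint, as gluing requires.\<close>

lemma transition:
  assumes K: "1 \<le> K" and s: "\<bar>s\<bar> < L"
  shows "W K (x, y, s + 6*L) = exp (- K * \<Gamma>) * W (2*K) (y, x, s)"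
    and "i < 2 \<Longrightarrow> j < 2 \<Longrightarrow> B K i j (x, y, s + 6*L) = B (2*K) (1 - i) (1 - j) (y, x, s)"
proof -
  have A: "s + 5*L \<ge> L" "s + 4*L \<ge> L" "s + 3*L \<ge> L" "s + 2*L \<ge> L"
    and b: "s - L \<le> 0" "s - 2*L \<le> 0" "s - 3*L \<le> 0" "s - 4*L \<le> 0"
    using s by auto
  have e: "s + 6*L - L = s + 5*L" "s + 6*L - 2*L = s + 4*L" "s + 6*L - 3*L = s + 3*L" "s + 6*L - 4*L = s + 2*L"
    by simp_all
  note f = A[THEN after] b[THEN before]
  have p: "phase (s + 6*L) = 2 * s + \<Gamma>" "phase s = s"
    using f by (simp_all add: phase_def \<Gamma>_def e)
  show "W K (x, y, s + 6*L) = exp (- K * \<Gamma>) * W (2*K) (y, x, s)"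
    using f by (simp add: W_def modes_def \<alpha>_def \<beta>_def tc_def e p)
      (simp add: exp_add[symmetric] algebra_simps)
  have "K \<noteq> 0" using K by simp
  then show "B K i j (x, y, s + 6*L) = B (2*K) (1 - i) (1 - j) (y, x, s)" if "i < 2" "j < 2"
    using f that by (auto simp: B_def prodmode_def tc_def e \<gamma>_def a0_def a1_def field_simps less_2_cases_iff)
qed

subsection \<open>The infinite cascade\<close>

sublocale gluing "6*L" L
  using ell by unfold_locales auto

definition Kn :: "nat \<Rightarrow> real" where "Kn n = real k * 2^n"

text \<open>This is the product of the factors \<open>exp (- Kn j * \<Gamma>)\<close> over
  \<open>j < n\<close>, since the frequencies k 2^j sum to k 2^n - k.\<close>

definition En :: "nat \<Rightarrow> real" where "En n = exp (- \<Gamma> * (Kn n - real k))"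

text \<open>Passage to the local coordinates of a step: odd steps exchange \<open>x\<close> and
  \<open>y\<close>. The map \<open>prm\<close> is the matching permutation of indices.\<close>

definition \<tau> :: "nat \<Rightarrow> pt \<Rightarrow> pt" where
  "\<tau> n p = (if even n then (fst p, fst (snd p), tc p - real n * (6*L))
            else (fst (snd p), fst p, tc p - real n * (6*L)))"

definition prm :: "nat \<Rightarrow> nat \<Rightarrow> nat" where
  "prm n i = (if odd n \<and> i < 2 then 1 - i else i)"

lemma prm_less: "i < 2 \<Longrightarrow> prm n i < 2" "i < 3 \<Longrightarrow> prm n i < 3" "prm n 2 = 2"
  by (auto simp: prm_def)

lemma tau_ev: "\<tau> n (p + s *\<^sub>R ev i) = \<tau> n p + s *\<^sub>R ev (prm n i)"
  by (auto simp: \<tau>_def prm_def ev_def tc_def prod_eq_iff)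

lemma tc_tau: "tc (\<tau> n p) = tc p - real n * (6*L)"
  by (simp add: \<tau>_def tc_def)

lemma hasD_tau: "hasD (prm n i) f f' \<Longrightarrow> hasD i (\<lambda>p. f (\<tau> n p)) (\<lambda>p. f' (\<tau> n p))"
  unfolding hasD_def tau_ev by blast

lemma continuous_tau: "continuous_on UNIV (\<tau> n)"
  by (cases "even n") (auto simp: \<tau>_def tc_def intro!: continuous_intros)

lemma Kn: "1 \<le> Kn n" "\<bar>\<mu>\<bar> / Kn n ^ 2 \<le> 1/1000" "real k \<le> Kn n" "Kn (Suc n) = 2 * Kn n"
proof -
  have k1: "1 \<le> real k" using k_pos by simp
  have "real k * 1 \<le> real k * 2^n" by (intro mult_left_mono one_le_power) auto
  then show kn: "real k \<le> Kn n" by (simp add: Kn_def)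
  then show "1 \<le> Kn n" using k1 by simp
  have "\<bar>\<mu>\<bar> / Kn n ^ 2 \<le> \<bar>\<mu>\<bar> / real k ^ 2"
    using kn k1 by (intro divide_left_mono power_mono) auto
  then show "\<bar>\<mu>\<bar> / Kn n ^ 2 \<le> 1/1000" using mu_k by (rule order.trans)
  show "Kn (Suc n) = 2 * Kn n" by (simp add: Kn_def)
qed

lemma En_Suc: "En (Suc n) = En n * exp (- Kn n * \<Gamma>)"
  unfolding En_def Kn(4) by (simp add: exp_add[symmetric] algebra_simps)

definition U where "U n p = En n * W (Kn n) (\<tau> n p)"
definition U1 where "U1 i n p = En n * W1 (Kn n) (prm n i) (\<tau> n p)"
definition U2 where "U2 i j n p = En n * W2 (Kn n) (prm n i) (prm n j) (\<tau> n p)"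
definition A where "A i j n p = B (Kn n) (prm n i) (prm n j) (\<tau> n p)"
definition A1 where "A1 i j l n p = B1 (Kn n) (prm n i) (prm n j) (prm n l) (\<tau> n p)"

lemma hasD_step:
  "i < 3 \<Longrightarrow> hasD i (U n) (U1 i n)"
  "i < 3 \<Longrightarrow> j < 3 \<Longrightarrow> hasD j (U1 i n) (U2 i j n)"
  "i < 2 \<Longrightarrow> j < 2 \<Longrightarrow> l < 3 \<Longrightarrow> hasD l (A i j n) (A1 i j l n)"
  unfolding U_def[abs_def] U1_def[abs_def] U2_def[abs_def] A_def[abs_def] A1_def[abs_def]
  by (auto intro!: hasD_cmult hasD_tau W_hasD W1_hasD B_hasD prm_less)

lemma continuous_step:
  "continuous_on UNIV (U n)" "continuous_on UNIV (U1 i n)" "continuous_on UNIV (U2 i j n)"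
  "continuous_on UNIV (A i j n)" "continuous_on UNIV (A1 i j l n)"
  unfolding U_def[abs_def] U1_def[abs_def] U2_def[abs_def] A_def[abs_def] A1_def[abs_def]
  by (intro continuous_intros continuous_on_compose2[OF W_cont(1) continuous_tau]
    continuous_on_compose2[OF W_cont(2) continuous_tau] continuous_on_compose2[OF W_cont(3) continuous_tau]
    continuous_on_compose2[OF W_cont(4) continuous_tau] continuous_on_compose2[OF W_cont(5) continuous_tau]; simp)+

lemma compat_UA: "compat U" "i < 2 \<Longrightarrow> j < 2 \<Longrightarrow> compat (A i j)"
proof -
  have *: "U n p = U (Suc n) p \<and> (i < 2 \<longrightarrow> j < 2 \<longrightarrow> A i j n p = A i j (Suc n) p)"
    if p: "\<bar>tc p - real (Suc n) * (6*L)\<bar> < L" for n p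
  proof -
    obtain x y t where pe: "p = (x, y, t)" by (cases p)
    define s where "s = t - real (Suc n) * (6*L)"
    have s: "\<bar>s\<bar> < L" using p by (simp add: s_def pe tc_def)
    have e: "t - real n * (6*L) = s + 6*L" by (simp add: s_def algebra_simps)
    have t: "\<tau> n p = (if even n then (x, y, s + 6*L) else (y, x, s + 6*L))"
      "\<tau> (Suc n) p = (if even n then (y, x, s) else (x, y, s))"
      unfolding \<tau>_def pe by (auto simp: tc_def e s_def)
    note tr = transition[OF Kn(1)[of n] s]
    have "U n p = U (Suc n) p"
      unfolding U_def t En_Suc Kn(4) by (simp add: tr(1))
    \<comment> \<open>For even \<open>n\<close> the transition is used at the indices themselves,
      for odd \<open>n\<close> at the exchanged ones.\<close>
    moreover have "A i j n p = A i j (Suc n) p" if "i < 2" "j < 2"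
      unfolding A_def t Kn(4) using that tr(2)[of i j] tr(2)[of "1 - i" "1 - j"]
      by (auto simp: prm_def less_2_cases_iff)
    ultimately show ?thesis by blast
  qed
  show "compat U" unfolding compat_def using * by blast
  show "compat (A i j)" if "i < 2" "j < 2" unfolding compat_def using * that by blast
qed

lemma compat_derivs:
  "i < 3 \<Longrightarrow> compat (U1 i)"
  "i < 3 \<Longrightarrow> j < 3 \<Longrightarrow> compat (U2 i j)"
  "i < 2 \<Longrightarrow> j < 2 \<Longrightarrow> l < 3 \<Longrightarrow> compat (A1 i j l)"
proof -
  show 1: "compat (U1 i)" if "i < 3" for i
    using compat_UA(1) hasD_step(1)[OF that] by (rule compat_hasD)
  show "i < 3 \<Longrightarrow> j < 3 \<Longrightarrow> compat (U2 i j)"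
    using compat_hasD[OF 1[of i] hasD_step(2)[of i j]] by blast
  show "i < 2 \<Longrightarrow> j < 2 \<Longrightarrow> l < 3 \<Longrightarrow> compat (A1 i j l)"
    using compat_hasD[OF compat_UA(2)[of i j] hasD_step(3)[of i j l]] by blast
qed

lemma hasD_glued:
  "i < 3 \<Longrightarrow> hasD i (glue U) (glue (U1 i))"
  "i < 3 \<Longrightarrow> j < 3 \<Longrightarrow> hasD j (glue (U1 i)) (glue (U2 i j))"
  "i < 2 \<Longrightarrow> j < 2 \<Longrightarrow> l < 3 \<Longrightarrow> hasD l (glue (A i j)) (glue (A1 i j l))"
  by (auto intro!: glue_hasD compat_UA compat_derivs hasD_step)

lemma pd_glued:
  "i < 3 \<Longrightarrow> pd i (glue U) = glue (U1 i)"
  "i < 3 \<Longrightarrow> j < 3 \<Longrightarrow> pd j (glue (U1 i)) = glue (U2 i j)"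
  "i < 2 \<Longrightarrow> j < 2 \<Longrightarrow> l < 3 \<Longrightarrow> pd l (glue (A i j)) = glue (A1 i j l)"
  by (simp_all add: hasD_pd[OF hasD_glued(1)] hasD_pd[OF hasD_glued(2)] hasD_pd[OF hasD_glued(3)])

lemma C1_glued:
  "C1_on S (glue U)" "i < 3 \<Longrightarrow> C1_on S (glue (U1 i))"
  "i < 2 \<Longrightarrow> j < 2 \<Longrightarrow> C1_on S (glue (A i j))"
  by (rule C1_onI glue_continuous compat_UA compat_derivs continuous_step hasD_glued; assumption?)+

section \<open>Equation, regularity and periodicity of the glued functions\<close>

lemma glued_pde:
  "pd 2 (pd 2 (glue U)) p + (\<Sum>i<2. \<Sum>j<2. pd i (\<lambda>q. glue (A i j) q * pd j (glue U) q) p) = - \<mu> * glue U p"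
proof -
  define n where "n = idx (tc p)"
  define K where "K = Kn n"
  define q where "q = \<tau> n p"
  have flux: "pd i (\<lambda>q. glue (A i j) q * pd j (glue U) q) p =
      En n * (B1 K (prm n i) (prm n j) (prm n i) q * W1 K (prm n j) q
        + B K (prm n i) (prm n j) q * W2 K (prm n j) (prm n i) q)" if "i < 2" "j < 2" for i j
  proof -
    have "hasD i (\<lambda>q. glue (A i j) q * glue (U1 j) q)
      (\<lambda>q. glue (A1 i j i) q * glue (U1 j) q + glue (A i j) q * glue (U2 j i) q)"
      using that by (intro hasD_mult hasD_glued) auto
    then show ?thesis
      using that by (simp add: pd_glued hasD_pd)
        (simp add: glue_def n_def[symmetric] A1_def A_def U1_def U2_def K_def q_def, simp add: algebra_simps)
  qed
  have "pd 2 (pd 2 (glue U)) p = En n * W2 K 2 2 q"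
    by (simp add: pd_glued glue_def U2_def n_def[symmetric] K_def q_def prm_less)
  \<comment> \<open>For odd \<open>n\<close> the index permutation merely reorders the four
    summands.\<close>
  moreover have "(\<Sum>i<2. \<Sum>j<2. pd i (\<lambda>q. glue (A i j) q * pd j (glue U) q) p)
     = En n * (\<Sum>i<2. \<Sum>j<2. B1 K i j i q * W1 K j q + B K i j q * W2 K j i q)"
    by (cases "even n") (simp_all add: sum2 flux, simp_all add: prm_def algebra_simps)
  moreover have "glue U p = En n * W K q"
    by (simp add: glue_def U_def n_def[symmetric] K_def q_def)
  moreover have "En n * W2 K 2 2 q + En n * (\<Sum>i<2. \<Sum>j<2. B1 K i j i q * W1 K j q + B K i j q * W2 K j i q)
     = En n * (- \<mu> * W K q)"
    unfolding distrib_left[symmetric] K_def step_pde[OF Kn(1)] by simp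
  ultimately show ?thesis by simp
qed

lemma glued_reg_class: "reg_class S 100 61 (\<lambda>i j. glue (A i j))"
  unfolding reg_class_def
proof (intro conjI allI impI ballI)
  fix p :: pt and x y :: real
  define n where "n = idx (tc p)"
  note b = B_bounds(1-6)[OF Kn(1,2)[of n], of "\<tau> n p"]
  have "1/100 * (x^2 + y^2) \<le> (\<Sum>i<2. \<Sum>j<2. (if i = 0 then x else y) * glue (A i j) p * (if j = 0 then x else y)) \<and>
    (\<Sum>i<2. \<Sum>j<2. (if i = 0 then x else y) * glue (A i j) p * (if j = 0 then x else y)) \<le> 100 * (x^2 + y^2)"
  proof (cases "even n")
    case True
    then show ?thesis using ellipticity[OF b, of x y]
      by (simp add: sum2 glue_def A_def n_def[symmetric] prm_def)
  next
    case False
    then show ?thesis using ellipticity[OF b, of y x]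
      by (simp add: sum2 glue_def A_def n_def[symmetric] prm_def)
  qed
  then show "1/100 * (x^2 + y^2) \<le> (\<Sum>i<2. \<Sum>j<2. (if i = 0 then x else y) * glue (A i j) p * (if j = 0 then x else y))"
    "(\<Sum>i<2. \<Sum>j<2. (if i = 0 then x else y) * glue (A i j) p * (if j = 0 then x else y)) \<le> 100 * (x^2 + y^2)"
    by auto
next
  fix i j l :: nat and p :: pt assume "i < 2" "j < 2" "l < 3"
  then show "\<bar>pd l (glue (A i j)) p\<bar> \<le> 61"
    by (simp add: pd_glued glue_def A1_def B_bounds(7)[OF Kn(1,2)])
qed (rule C1_glued)

lemma cos_sin_shift:
  "cos (real m * (x + 2*pi)) = cos (real m * x)" "sin (real m * (x + 2*pi)) = sin (real m * x)"
proof -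
  have "real m * (x + 2*pi) = real m * x + real m * (2*pi)" by (simp add: algebra_simps)
  then show "cos (real m * (x + 2*pi)) = cos (real m * x)" "sin (real m * (x + 2*pi)) = sin (real m * x)"
    using cos.plus_of_nat[of "real m * x" m] sin.plus_of_nat[of "real m * x" m] by simp_all
qed

lemma step_periodic:
  "W (real m) (x + 2*pi, y, t) = W (real m) (x, y, t)" "W (real m) (x, y + 2*pi, t) = W (real m) (x, y, t)"
  "B (real m) i j (x + 2*pi, y, t) = B (real m) i j (x, y, t)"
  "B (real m) i j (x, y + 2*pi, t) = B (real m) i j (x, y, t)"
  using cos_sin_shift[of "2*m"] cos_sin_shift[of m]
  by (auto simp: W_def B_def modes_def prodmode_def tc_def)

lemma glued_periodic: "periodic2 (glue U)" "periodic2 (glue (A i j))"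
proof -
  \<comment> \<open>Integrality of the frequencies is what makes all modes 2 pi-periodic.\<close>
  have "Kn n = real (k * 2^n)" for n by (simp add: Kn_def)
  then show "periodic2 (glue U)" "periodic2 (glue (A i j))"
    unfolding periodic2_def glue_def U_def A_def \<tau>_def
    by (simp_all only: step_periodic tc_def fst_conv snd_conv if_distrib[of "\<lambda>p. W _ p"]
      if_distrib[of "\<lambda>p. B _ _ _ p"]) auto
qed

section \<open>Uniform C^2 bounds and doubly exponential decay\<close>

lemma En_bound: "En n * (Kn n)^2 \<le> 2 * exp (real k)"
proof -
  \<comment> \<open>Second derivatives grow like the squared frequency; since \<Gamma> \<ge> 1, the
    accumulated factor \<open>En n\<close> decays fast enough to absorb this.\<close>
  have "1 + Kn n + (Kn n)^2 / 2 \<le> exp (Kn n)"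
    using Kn(1)[of n] by (intro exp_lower_Taylor_quadratic) simp
  then have "(Kn n)^2 \<le> 2 * exp (Kn n)" using Kn(1)[of n] by simp
  moreover have "En n \<le> exp (- (Kn n - real k))"
    unfolding En_def using Gamma_ge mult_right_mono[of 1 \<Gamma> "Kn n - real k"] Kn(3)[of n] by simp
  ultimately have "En n * (Kn n)^2 \<le> exp (- (Kn n - real k)) * (2 * exp (Kn n))"
    by (intro mult_mono) auto
  also have "\<dots> = 2 * exp (real k)" by (simp add: exp_add[symmetric])
  finally show ?thesis .
qed

lemma glued_bounds:
  assumes "0 < tc p"
  shows "\<bar>glue U p\<bar> \<le> 2 * En (idx (tc p))" "\<bar>glue U p\<bar> \<le> 24 * exp (real k)"
    "\<bar>glue (U1 i) p\<bar> \<le> 24 * exp (real k)" "\<bar>glue (U2 i j) p\<bar> \<le> 24 * exp (real k)"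
proof -
  define n where "n = idx (tc p)"
  have s: "0 \<le> tc (\<tau> n p)"
    using idx_bounds(1)[of "tc p"] assms by (simp add: tc_tau n_def)
  note b = step_bounds[OF Kn(1)[of n] s]
  have E: "0 \<le> En n" "\<bar>En n\<bar> \<le> En n" by (simp_all add: En_def)
  have e: "\<bar>En n * w\<bar> \<le> 24 * exp (real k)" if "\<bar>w\<bar> \<le> 12 * (Kn n)^2" for w
    using abs_mult_le[OF E(2) that] En_bound[of n] by simp
  show "\<bar>glue U p\<bar> \<le> 2 * En (idx (tc p))"
    using abs_mult_le[OF E(2) b(1)] by (simp only: glue_def U_def n_def[symmetric] mult.commute[of 2])
  have "\<bar>W (Kn n) (\<tau> n p)\<bar> \<le> 12 * (Kn n)^2" using b(1) K_square(1)[OF Kn(1)[of n]] by linarith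
  then show "\<bar>glue U p\<bar> \<le> 24 * exp (real k)"
    unfolding glue_def U_def n_def[symmetric] by (rule e)
  show "\<bar>glue (U1 i) p\<bar> \<le> 24 * exp (real k)" "\<bar>glue (U2 i j) p\<bar> \<le> 24 * exp (real k)"
    unfolding glue_def U1_def U2_def n_def[symmetric] by (rule e b)+
qed

lemma glued_C2: "uniformly_C2_on Hplus (glue U)"
proof -
  have b: "bounded (f ` Hplus)" if "\<And>p. 0 < tc p \<Longrightarrow> \<bar>f p\<bar> \<le> 24 * exp (real k)" for f :: "pt \<Rightarrow> real"
    using that by (auto simp: bounded_iff Hplus_def)
  show ?thesis
    unfolding uniformly_C2_on_def by (auto simp: pd_glued intro!: C1_glued b glued_bounds)
qed

lemma glued_decay:
  "\<exists>c C T0. c > 0 \<and> C > 0 \<and> (\<forall>T \<ge> T0. \<forall>p. tc p \<ge> T \<longrightarrow> \<bar>glue U p\<bar> \<le> C * exp (- c * exp (c * T)))"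
proof -
  \<comment> \<open>The second bound makes \<open>exp (c * T)\<close> at most 2^(n+1), because
    \<open>T\<close> lies before the end of step \<open>n\<close>; the half in the first bound turns
    2^(n+1) back into 2^n.\<close>
  define c where "c = min (\<Gamma> * real k / 2) (ln 2 / (6*L))"
  have c: "c > 0" "c \<le> \<Gamma> * real k / 2" "c \<le> ln 2 / (6*L)"
    unfolding c_def using Gamma_ge k_pos ell by auto
  have "\<bar>glue U p\<bar> \<le> 2 * exp (\<Gamma> * real k) * exp (- c * exp (c * T))" if T: "1 \<le> T" "T \<le> tc p" for T p
  proof -
    define n where "n = idx (tc p)"
    have "tc p < real (Suc n) * (6*L)" using idx_upper unfolding n_def .
    then have "T \<le> real (Suc n) * (6*L)" using T by simp
    then have "c * T \<le> ln 2 / (6*L) * (real (Suc n) * (6*L))"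
      using c T by (intro mult_mono) auto
    also have "\<dots> = real (Suc n) * ln 2" using ell by simp
    finally have "exp (c * T) \<le> exp (real (Suc n) * ln 2)" by simp
    also have "\<dots> = 2 ^ Suc n" by (simp only: exp_of_nat_mult) simp
    finally have "c * exp (c * T) \<le> \<Gamma> * real k / 2 * 2 ^ Suc n"
      using c by (intro mult_mono) auto
    then have "c * exp (c * T) \<le> \<Gamma> * Kn n" by (simp add: Kn_def)
    then have "En n \<le> exp (\<Gamma> * real k + - c * exp (c * T))"
      unfolding En_def by (simp add: algebra_simps)
    moreover have "\<bar>glue U p\<bar> \<le> 2 * En n"
      using glued_bounds(1)[of p] T unfolding n_def by simp
    ultimately show ?thesis unfolding exp_add by simp
  qed
  then show ?thesis
    \<comment> \<open>The constant contains the offset \<open>exp (\<Gamma> * real k)\<close> of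
      \<open>En\<close>; starting at 1 keeps the times positive.\<close>
    using c(1) by (intro exI[of _ c] exI[of _ "2 * exp (\<Gamma> * real k)"] exI[of _ 1]) auto
qed

text \<open>The earliest cutoff starts at time \<open>L \<ge> 1\<close>, so up to 1/100 only the
  initial mode and the initial diagonal are visible.\<close>

lemma glued_initial:
  assumes "t \<le> 1/100"
  shows "glue U (x, y, t) = cos (real k * x) * exp (- real k * t)"
    "glue (A 0 0) (x, y, t) = 1 + \<mu> / real k ^ 2" "glue (A 0 (Suc 0)) (x, y, t) = 0"
    "glue (A (Suc 0) 0) (x, y, t) = 0" "glue (A (Suc 0) (Suc 0)) (x, y, t) = 1 + \<mu> / (4 * real k ^ 2)"
proof -
  have i: "idx t = 0" using assms ell by (intro idx_0) simp
  have "t - L \<le> 0" "t - 2*L \<le> 0" "t - 3*L \<le> 0" "t - 4*L \<le> 0" using assms ell by simp_all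
  note f = this[THEN before]
  show "glue U (x, y, t) = cos (real k * x) * exp (- real k * t)"
    using f by (simp add: glue_def i tc_def U_def W_def modes_def En_def Kn_def \<tau>_def \<alpha>_def \<beta>_def)
  show "glue (A 0 0) (x, y, t) = 1 + \<mu> / real k ^ 2" "glue (A 0 (Suc 0)) (x, y, t) = 0"
    "glue (A (Suc 0) 0) (x, y, t) = 0" "glue (A (Suc 0) (Suc 0)) (x, y, t) = 1 + \<mu> / (4 * real k ^ 2)"
    using f by (simp_all add: glue_def i tc_def A_def B_def prodmode_def Kn_def \<tau>_def prm_def a0_def a1_def \<gamma>_def)
      (simp_all add: field_simps)
qed

end

theorem mainTheorem5:
  fixes \<mu> :: real
  shows "\<exists>(A :: nat \<Rightarrow> nat \<Rightarrow> pt \<Rightarrow> real) (u :: pt \<Rightarrow> real).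
     (\<forall>i<2. \<forall>j<2. periodic2 (A i j)) \<and> reg_class Hplus 100 61 A \<and>
     periodic2 u \<and> uniformly_C2_on Hplus u \<and> (\<exists>p\<in>Hplus. u p \<noteq> 0) \<and>
     (\<forall>p\<in>Hplus. pd 2 (pd 2 u) p + (\<Sum>i<2. \<Sum>j<2. pd i (\<lambda>q. A i j q * pd j u q) p) = - \<mu> * u p) \<and>
     (\<exists>c C T0. c > 0 \<and> C > 0 \<and>
        (\<forall>T \<ge> T0. \<forall>p. tc p \<ge> T \<longrightarrow> \<bar>u p\<bar> \<le> C * exp (- c * exp (c * T)))) \<and>
     (\<exists>k::nat. k > 0 \<and> \<bar>\<mu>\<bar> / real k ^ 2 \<le> 1/1000 \<and>
        (\<forall>x y t. 0 \<le> t \<and> t \<le> 1/100 \<longrightarrow>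
           u (x, y, t) = cos (real k * x) * exp (- real k * t) \<and>
           A 0 0 (x, y, t) = 1 + \<mu> / real k ^ 2 \<and> A 0 1 (x, y, t) = 0 \<and>
           A 1 0 (x, y, t) = 0 \<and> A 1 1 (x, y, t) = 1 + \<mu> / (4 * real k ^ 2)))"
proof -
  \<comment> \<open>Chosen so that 1000 |\<mu>| \<le> k \<le> k^2; the successor keeps
    \<open>k\<close> positive when \<mu> = 0.\<close>
  define k where "k = Suc (nat \<lceil>1000 * \<bar>\<mu>\<bar>\<rceil>)"
  have k: "k > 0" "1000 * \<bar>\<mu>\<bar> \<le> real k" "1 \<le> real k" unfolding k_def by (simp_all, linarith)
  have "real k \<le> real k ^ 2" using k(3) by (simp add: self_le_power)
  then have "1000 * \<bar>\<mu>\<bar> \<le> real k ^ 2" using k(2) by linarith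
  then have mu: "\<bar>\<mu>\<bar> / real k ^ 2 \<le> 1/1000" using k(1) by (simp add: field_simps)
  obtain \<theta> \<theta>1 \<theta>2 \<theta>3 X L \<kappa> where "cutoff \<theta> \<theta>1 \<theta>2 \<theta>3 X L \<kappa>"
    using cutoff_exists by blast
  then interpret cutoff \<theta> \<theta>1 \<theta>2 \<theta>3 X L \<kappa> .
  interpret cascade \<theta> \<theta>1 \<theta>2 \<theta>3 X L \<kappa> \<mu> k
    by unfold_locales (use k mu in auto)
  have "glue U (0, 0, 1/100) \<noteq> 0" by (simp add: glued_initial)
  then have nz: "\<exists>p\<in>Hplus. glue U p \<noteq> 0"
    by (intro bexI[of _ "(0, 0, 1/100)"]) (auto simp: Hplus_def tc_def)
  show ?thesis
    by (intro exI[of _ "\<lambda>i j. glue (A i j)"] exI[of _ "glue U"] conjI allI impI ballI exI[of _ k]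
        glued_periodic glued_reg_class glued_C2 nz glued_pde glued_decay k mu)
      (simp_all add: glued_initial)
qed

end
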